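(* Let $g$ be a positive integer and let $\mathcal{U}\subset\mathbb{R}^{2g}$ be the open set of $2g$-tuples $a=(a_1,\dots,a_{2g})$ of real numbers with $-1<a_1<\cdots<a_{2g}<1$. Let $M^{-1}v:\mathcal{U}\to\mathbb{R}^g$ be the real-analytic period map $a\mapsto M(a)^{-1}v(a)$ associated with the hyperelliptic curves $y^2=(x^2-1)\prod_{i=1}^{2g}(x-a_i)$ (defined in the context). Then the derivative of $M^{-1}v$ is generically of full rank: the $g\times 2g$ Jacobian matrix of first partial derivatives of $M^{-1}v$ has rank $g$ at every point of $\mathcal{U}$ outside a proper real-analytic subset of $\mathcal{U}$.
   Context: For $a\in\mathcal{U}$ put $f(x)=(x^2-1)\prod_{i=1}^{2g}(x-a_i)$; $f$ is positive on each interval $(a_{2j-1},a_{2j})$, $1\le j\le g$, and on $(1,\infty)$, and $\sqrt{f}$ denotes the positive square root there. Let $p_1,\dots,p_g$ be any basis of the space of real polynomials of degree at most $g-1$, and let $\omega_i=p_i(x)\,dx/\sqrt{f(x)}$ (these correspond to a basis of the global differentials $p_i(x)\,dx/y$ on the curve). Let $M(a)$ be the real $g\times g$ matrix with $(i,j)$ entry $2\int_{a_{2j-1}}^{a_{2j}}\omega_i$, and let $v(a)\in\mathbb{R}^g$ be the vector with entries $v_i=2\int_1^\infty\omega_i$. The matrix $M(a)$ is invertible, and $M(a)^{-1}v(a)$ does not depend on the choice of the basis $p_1,\dots,p_g$; the resulting function $M^{-1}v:\mathcal{U}\to\mathbb{R}^g$ is real-analytic. *)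

theory Defs
  imports "HOL-Analysis.Analysis" "HOL-Computational_Algebra.Polynomial"
begin

text \<open>
  Coordinates of \<open>real ^ 'n\<close> are ordered by the linear order of the finite index type \<open>'n\<close>.
  \<open>nth_index k\<close> is the \<open>k\<close>-th index in increasing order and \<open>index_pos i\<close> is the position of
  the index \<open>i\<close>, both counted from 1, so that \<open>a $ nth_index k\<close> is the usual \<open>a\<^sub>k\<close>.
\<close>

definition nth_index :: "nat \<Rightarrow> 'n::{finite,linorder}"
  where "nth_index k = sorted_list_of_set (UNIV :: 'n set) ! (k - 1)"

definition index_pos :: "'n::{finite,linorder} \<Rightarrow> nat"
  where "index_pos i = card {..i}"

definition param_space :: "(real ^ 'n::{finite,linorder}) set"
  where "param_space = {a. strict_mono (\<lambda>k. a $ k) \<and> (\<forall>k. -1 < a $ k \<and> a $ k < 1)}"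

definition curve_poly :: "real ^ 'n::finite \<Rightarrow> real \<Rightarrow> real"
  where "curve_poly a x = (x\<^sup>2 - 1) * (\<Prod>k\<in>UNIV. (x - a $ k))"

definition poly_basis :: "nat \<Rightarrow> ('i \<Rightarrow> real poly) \<Rightarrow> bool"
  where "poly_basis d p \<longleftrightarrow>
    inj p \<and> module.independent smult (range p) \<and> module.span smult (range p) = {q. degree q \<le> d}"

definition diff_form :: "real poly \<Rightarrow> real ^ 'n::finite \<Rightarrow> real \<Rightarrow> real"
  where "diff_form q a x = poly q x / sqrt (curve_poly a x)"

definition period_matrix ::
    "('m::{finite,linorder} \<Rightarrow> real poly) \<Rightarrow> real ^ 'n::{finite,linorder} \<Rightarrow> real ^ 'm::{finite,linorder} ^ 'm::{finite,linorder}"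
  where "period_matrix p a = (\<chi> i j.
    2 * (LBINT x = ereal (a $ nth_index (2 * index_pos j - 1)) .. ereal (a $ nth_index (2 * index_pos j)).
           diff_form (p i) a x))"

definition period_vector :: "('m::{finite,linorder} \<Rightarrow> real poly) \<Rightarrow> real ^ 'n::finite \<Rightarrow> real ^ 'm::{finite,linorder}"
  where "period_vector p a = (\<chi> i. 2 * (LBINT x = ereal 1 .. \<infinity>. diff_form (p i) a x))"

definition period_map ::
    "('m::{finite,linorder} \<Rightarrow> real poly) \<Rightarrow> real ^ 'n::{finite,linorder} \<Rightarrow> real ^ 'm::{finite,linorder}"
  where "period_map p a = matrix_inv (period_matrix p a) *v period_vector p a"

text \<open>
  Real-analyticity: near every point the function is the sum of an (unconditionally, hence
  absolutely) convergent power series, whose terms are indexed by multi-indices \<open>\<alpha> :: 'n \<Rightarrow> nat\<close>.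
\<close>

definition real_analytic_on :: "(real ^ 'n \<Rightarrow> real) \<Rightarrow> (real ^ 'n) set \<Rightarrow> bool"
    (infix \<open>real'_analytic'_on\<close> 50)
  where "f real_analytic_on W \<longleftrightarrow>
    (\<forall>x\<in>W. \<exists>(c :: ('n \<Rightarrow> nat) \<Rightarrow> real) r. r > 0 \<and>
      (\<forall>y\<in>ball x r. ((\<lambda>\<alpha>. c \<alpha> * (\<Prod>i\<in>UNIV. (y $ i - x $ i) ^ \<alpha> i)) has_sum f y) UNIV))"

text \<open>
  A real-analytic subset of an open set \<open>U\<close> is a subset which, near every point of \<open>U\<close> (not just near
  its own points, so that it is closed in \<open>U\<close>), is the common zero set of finitely many
  real-analytic functions.
\<close>

definition real_analytic_subset :: "(real ^ 'n) set \<Rightarrow> (real ^ 'n) set \<Rightarrow> bool"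
  where "real_analytic_subset U Z \<longleftrightarrow> Z \<subseteq> U \<and>
    (\<forall>x\<in>U. \<exists>W (\<Phi> :: (real ^ 'n \<Rightarrow> real) set).
      open W \<and> x \<in> W \<and> W \<subseteq> U \<and> finite \<Phi> \<and> (\<forall>h\<in>\<Phi>. h real_analytic_on W) \<and>
      Z \<inter> W = {y \<in> W. \<forall>h\<in>\<Phi>. h y = 0})"

end

theory Submission
  imports Defs
begin

text \<open>
  The exceptional set can be taken empty: the Jacobian has rank \<open>g\<close> at every point of \<open>U\<close>.

  Write \<open>f\<close> for the curve polynomial, \<open>I\<^sub>j(q)\<close> for the integral of \<open>q / sqrt f\<close> over the \<open>j\<close>-th gap and
  \<open>I\<^sub>\<infinity>(q)\<close> for its integral over \<open>(1, \<infinity>)\<close>. The period map \<open>c\<close> is characterised by the relation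
  \<open>\<Sum>\<^sub>j I\<^sub>j(q) c\<^sub>j = I\<^sub>\<infinity>(q)\<close> for all \<open>q\<close> of degree at most \<open>g - 1\<close>. A covector orthogonal to the range
  of the derivative of \<open>c\<close> has, since the period matrix is invertible, the form \<open>(I\<^sub>j(q))\<^sub>j\<close> for one
  such \<open>q\<close>. So it suffices to find, for every \<open>q \<noteq> 0\<close>, a velocity \<open>u\<close> of the branch points along which
  \<open>\<Sum>\<^sub>j I\<^sub>j(q) D\<^sub>u c\<^sub>j \<noteq> 0\<close>.

  As \<open>q\<close> has at most \<open>g - 1\<close> roots, there is a set \<open>A\<close> of \<open>g + 1\<close> indices with \<open>q(a\<^sub>k) \<noteq> 0\<close> for \<open>k\<close> in \<open>A\<close>. Let
  \<open>B\<close> be the monic polynomial of degree \<open>g + 1\<close> whose roots are the remaining branch points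
  (\<open>1\<close> and \<open>-1\<close> among them), and move \<open>a\<^sub>k\<close> with velocity \<open>u\<^sub>k = B(a\<^sub>k) / q(a\<^sub>k)\<close> for \<open>k\<close> in \<open>A\<close> and \<open>0\<close> otherwise.
  The formal variation of \<open>q / sqrt f\<close> is \<open>(q / 2) \<Sum>\<^sub>k u\<^sub>k / (x - a\<^sub>k) / sqrt f\<close>. Its poles are those of
  the derivative of \<open>- B / sqrt f\<close>, and the two differ by \<open>Q / sqrt f\<close> for
  a polynomial \<open>Q\<close>; the terms of degree \<open>g\<close> cancel because \<open>A\<close> has as many elements as \<open>B\<close> has roots, so \<open>Q\<close> has
  degree at most \<open>g - 1\<close> again (\<open>variation_identity\<close>, \<open>degree_variation_numerator\<close>).
  The exact term contributes nothing over a gap. Over \<open>(1, \<infinity>)\<close> it contributes \<open>-1\<close>, because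
  \<open>B / sqrt f\<close> goes from \<open>0\<close> at \<open>1\<close> to \<open>1\<close> at infinity. Hence \<open>D\<^sub>u I\<^sub>j(q) = I\<^sub>j(Q)\<close> and
  \<open>D\<^sub>u I\<^sub>\<infinity>(q) = I\<^sub>\<infinity>(Q) - 1\<close> (\<open>gap_variation\<close>, \<open>tail_variation\<close>). Differentiating the relation for \<open>q\<close> and
  subtracting the relation for \<open>Q\<close> leaves \<open>\<Sum>\<^sub>j I\<^sub>j(q) D\<^sub>u c\<^sub>j = -1\<close> (\<open>period_map_deriv_pairing\<close>).

  The integrands are singular at the branch points, which themselves move. The substitutions
  \<open>x = (a\<^sub>l + a\<^sub>r) / 2 - (a\<^sub>r - a\<^sub>l) / 2 * cos \<theta>\<close> on a gap and \<open>x = 1 / cos \<phi>\<close> on \<open>(1, \<infinity>)\<close> turn all periods into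
  integrals of smooth functions over fixed compact intervals. There differentiation under the
  integral sign is legitimate. On a gap the motion of \<open>x\<close> adds a second exact term to the formal
  variation; its singularities at the ends cancel those of the first, and the sum has zero boundary values.
\<close>

section \<open>The parameter space and its gaps\<close>

text \<open>
  Evenness of the number of branch points above the gap makes the curve polynomial positive on it.
\<close>
definition is_gap :: "'n::{finite,linorder} \<Rightarrow> 'n \<Rightarrow> bool"
  where "is_gap l r \<longleftrightarrow> l < r \<and> {l<..<r} = {} \<and> even (card {r<..})"

lemma param_spaceD:
  assumes "a \<in> param_space"
  shows "k < k' \<Longrightarrow> a $ k < a $ k'" "-1 < a $ k" "a $ k < 1"
  using assms by (auto simp: param_space_def strict_mono_def)

lemma convex_param_space: "convex (param_space :: (real ^ 'n::{finite,linorder}) set)"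
proof (rule convexI)
  fix a b :: "(real, 'n) vec" and s t :: real
  assume ab: "a \<in> param_space" "b \<in> param_space" and st: "0 \<le> s" "0 \<le> t" "s + t = 1"
  have comb: "s * x + t * y < s * x' + t * y'" if "x < x'" "y < y'" for x y x' y' :: real
  proof (cases "s = 0")
    case False
    then have "s * x < s * x'" "t * y \<le> t * y'"
      using st that by (auto intro: mult_left_mono)
    then show ?thesis by linarith
  qed (use st that in auto)
  have eq: "s * (-1) + t * (-1) = -1" "s * 1 + t * 1 = 1"
    using st by auto
  have "-1 < s * a $ k + t * b $ k \<and> s * a $ k + t * b $ k < 1" for k
    using comb[OF param_spaceD(2)[OF ab(1)] param_spaceD(2)[OF ab(2)]]
      comb[OF param_spaceD(3)[OF ab(1)] param_spaceD(3)[OF ab(2)]]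
    unfolding eq by simp
  then show "s *\<^sub>R a + t *\<^sub>R b \<in> param_space"
    using comb param_spaceD(1) ab by (auto simp: param_space_def strict_mono_def)
qed

lemma open_param_space: "open (param_space :: (real ^ 'n::{finite,linorder}) set)"
proof -
  have "param_space = (\<Inter>i\<in>(UNIV::'n set). \<Inter>j\<in>{i<..}. {a. a $ i < a $ j}) \<inter>
    (\<Inter>i\<in>(UNIV::'n set). {a. -1 < a $ i} \<inter> {a. a $ i < 1})"
    by (auto simp: param_space_def strict_mono_def)
  also have "open \<dots>"
    by (intro open_Int open_INT ballI finite open_Collect_less continuous_intros)
  finally show ?thesis .
qed

lemma param_space_nonempty: "(param_space :: (real ^ 'n::{finite,linorder}) set) \<noteq> {}"
proof -
  define a :: "(real, 'n) vec" where "a = (\<chi> k. real (card {..k}) / (CARD('n) + 1))"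
  have "card {..k} < card {..k'}" if "k < k'" for k k' :: 'n
    using that by (intro psubset_card_mono) auto
  moreover have "0 < card {..k}" "card {..k} \<le> CARD('n)" for k :: 'n
    by (auto simp: card_gt_0_iff intro: card_mono)
  ultimately have mono: "k < k' \<Longrightarrow> a $ k < a $ k'" and "0 < a $ k" "a $ k < 1" for k k'
    by (simp_all add: a_def divide_simps less_Suc_eq_le flip: of_nat_Suc)
  then have "-1 < a $ k" "a $ k < 1" for k
    by (auto intro: less_trans[of "-1" 0])
  with mono have "a \<in> param_space"
    by (auto simp: param_space_def strict_mono_def)
  then show ?thesis by auto
qed

lemma Compl_gap:
  assumes "is_gap l r" shows "- {l, r} = {..<l} \<union> {r<..}" "l \<noteq> r" "l < r"
proof -
  have "l < r" and gap: "k \<notin> {l<..<r}" for k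
    using assms by (auto simp only: is_gap_def)
  have "k < l \<or> r < k" if "k \<noteq> l" "k \<noteq> r" for k
    using gap[of k] that by (cases k l rule: linorder_cases; cases k r rule: linorder_cases) auto
  with \<open>l < r\<close> show "- {l, r} = {..<l} \<union> {r<..}" by auto
qed (use assms in \<open>auto simp: is_gap_def\<close>)

section \<open>Regularised integrands\<close>

text \<open>
  On the gap between \<open>a\<^sub>l\<close> and \<open>a\<^sub>r\<close> the curve polynomial is \<open>(x - a\<^sub>l) (a\<^sub>r - x)\<close> times this factor,
  which stays positive on the closed gap.
\<close>
definition gap_cofactor :: "'n \<Rightarrow> 'n \<Rightarrow> real ^ 'n::finite \<Rightarrow> real \<Rightarrow> real"
  where "gap_cofactor l r a x = (1 - x\<^sup>2) * (\<Prod>k\<in>-{l, r}. x - a $ k)"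

text \<open>
  The substitution satisfies \<open>(x - a\<^sub>l) (a\<^sub>r - x) = (dx / d\<theta>)\<^sup>2\<close>, so that it absorbs the singularities of the
  integrand at both ends. It is linear in \<open>a\<close>: applied to a velocity, it is the velocity of the point.
\<close>
definition gap_point :: "'n \<Rightarrow> 'n \<Rightarrow> real ^ 'n::finite \<Rightarrow> real \<Rightarrow> real"
  where "gap_point l r a \<theta> = (a $ l + a $ r) / 2 - (a $ r - a $ l) / 2 * cos \<theta>"

definition gap_integrand :: "'n \<Rightarrow> 'n \<Rightarrow> real poly \<Rightarrow> real ^ 'n::finite \<Rightarrow> real \<Rightarrow> real"
  where "gap_integrand l r q a \<theta> =
    poly q (gap_point l r a \<theta>) / sqrt (gap_cofactor l r a (gap_point l r a \<theta>))"

text \<open>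
  The reversed polynomial \<open>s\<^sup>d q(1 / s)\<close>, written so that it is meaningful at \<open>s = 0\<close>.
\<close>
definition poly_at_infinity :: "nat \<Rightarrow> real poly \<Rightarrow> real \<Rightarrow> real"
  where "poly_at_infinity d q s = (\<Sum>i\<le>d. coeff q i * s ^ (d - i))"

definition tail_integrand :: "nat \<Rightarrow> real poly \<Rightarrow> real ^ 'n::finite \<Rightarrow> real \<Rightarrow> real"
  where "tail_integrand d q a \<phi> =
    poly_at_infinity d q (cos \<phi>) / sqrt (\<Prod>k\<in>UNIV. 1 - a $ k * cos \<phi>)"

lemma gap_cofactor_pos:
  assumes a: "a \<in> param_space" and gap: "is_gap l r" and x: "a $ l \<le> x" "x \<le> a $ r"
  shows "gap_cofactor l r a x > 0"
proof -
  have "(\<Prod>k\<in>-{l, r}. x - a $ k) = (\<Prod>k\<in>{..<l}. x - a $ k) * (\<Prod>k\<in>{r<..}. x - a $ k)"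
    unfolding Compl_gap(1)[OF gap] using Compl_gap(3)[OF gap] by (intro prod.union_disjoint) auto
  also have "(\<Prod>k\<in>{r<..}. x - a $ k) = (\<Prod>k\<in>{r<..}. (-1) * (a $ k - x))"
    by (intro prod.cong) auto
  also have "\<dots> = (\<Prod>k\<in>{r<..}. a $ k - x)"
    using gap by (subst prod.distrib) (simp add: is_gap_def)
  finally have eq: "(\<Prod>k\<in>-{l, r}. x - a $ k) = (\<Prod>k\<in>{..<l}. x - a $ k) * (\<Prod>k\<in>{r<..}. a $ k - x)" .
  have "(\<Prod>k\<in>{..<l}. x - a $ k) > 0"
    using x param_spaceD(1)[OF a] by (intro prod_pos) force
  moreover have "(\<Prod>k\<in>{r<..}. a $ k - x) > 0"
    using x param_spaceD(1)[OF a] by (intro prod_pos) force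
  moreover have "x\<^sup>2 < 1"
    using x param_spaceD(2)[OF a, of l] param_spaceD(3)[OF a, of r]
    by (simp add: abs_square_less_1)
  ultimately show ?thesis
    unfolding gap_cofactor_def eq by simp
qed

lemma curve_poly_gap:
  assumes "l \<noteq> r"
  shows "curve_poly a x = (x - a $ l) * (a $ r - x) * gap_cofactor l r a x"
proof -
  have "(\<Prod>k\<in>UNIV. x - a $ k) = (\<Prod>k\<in>{l, r}. x - a $ k) * (\<Prod>k\<in>-{l,r}. x - a $ k)"
    by (subst prod.union_disjoint[symmetric]) (auto intro: prod.cong)
  then have "(\<Prod>k\<in>UNIV. x - a $ k) = (x - a $ l) * (x - a $ r) * (\<Prod>k\<in>-{l,r}. x - a $ k)"
    using assms by simp
  then show ?thesis
    unfolding curve_poly_def gap_cofactor_def by (simp only:) (simp add: algebra_simps)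
qed

lemma gap_point_bounds:
  assumes a: "a \<in> param_space" and gap: "is_gap l r"
  shows "a $ l \<le> gap_point l r a \<theta>" "gap_point l r a \<theta> \<le> a $ r"
proof -
  define d where "d = (a $ r - a $ l) / 2"
  have "d > 0" using param_spaceD(1)[OF a Compl_gap(3)[OF gap]] by (simp add: d_def)
  then have "d * cos \<theta> \<le> d * 1" "d * (-1) \<le> d * cos \<theta>"
    by (intro mult_left_mono; simp)+
  moreover have "a $ r - a $ l = 2 * d" by (simp add: d_def)
  ultimately show "a $ l \<le> gap_point l r a \<theta>" "gap_point l r a \<theta> \<le> a $ r"
    unfolding gap_point_def d_def[symmetric] by argo+
qed

lemma gap_point_factors:
  "(gap_point l r a \<theta> - a $ l) * (a $ r - gap_point l r a \<theta>) = ((a $ r - a $ l) / 2 * sin \<theta>)\<^sup>2"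
proof -
  define s c where "s = sin \<theta>" and "c = cos \<theta>"
  have "s\<^sup>2 + c\<^sup>2 = 1" by (simp add: s_def c_def)
  then show ?thesis
    unfolding gap_point_def s_def[symmetric] c_def[symmetric]
    by (simp add: field_simps) algebra
qed

lemma gap_cofactor_point_pos:
  assumes "a \<in> param_space" "is_gap l r"
  shows "gap_cofactor l r a (gap_point l r a \<theta>) > 0"
  using gap_cofactor_pos gap_point_bounds assms by blast

lemma sqrt_curve_poly_gap_point:
  assumes a: "a \<in> param_space" and gap: "is_gap l r" and \<theta>: "0 < \<theta>" "\<theta> < pi"
  shows "sqrt (curve_poly a (gap_point l r a \<theta>)) =
    (a $ r - a $ l) / 2 * sin \<theta> * sqrt (gap_cofactor l r a (gap_point l r a \<theta>))"
    and "curve_poly a (gap_point l r a \<theta>) > 0"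
    and "(a $ r - a $ l) / 2 * sin \<theta> > 0"
proof -
  show 1: "(a $ r - a $ l) / 2 * sin \<theta> > 0"
    using sin_gt_zero[OF \<theta>] param_spaceD(1)[OF a Compl_gap(3)[OF gap]] by simp
  show "sqrt (curve_poly a (gap_point l r a \<theta>)) =
    (a $ r - a $ l) / 2 * sin \<theta> * sqrt (gap_cofactor l r a (gap_point l r a \<theta>))"
    unfolding curve_poly_gap[OF Compl_gap(2)[OF gap]] gap_point_factors
    using 1 by (simp add: real_sqrt_mult)
  show "curve_poly a (gap_point l r a \<theta>) > 0"
    unfolding curve_poly_gap[OF Compl_gap(2)[OF gap]] gap_point_factors
    by (rule mult_pos_pos[OF zero_less_power[OF 1] gap_cofactor_point_pos[OF a gap]])
qed

lemma gap_integrand_eq: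
  assumes "a \<in> param_space" "is_gap l r" "0 < \<theta>" "\<theta> < pi"
  shows "gap_integrand l r q a \<theta> =
    (a $ r - a $ l) / 2 * sin \<theta> * diff_form q a (gap_point l r a \<theta>)"
proof -
  have "(a $ r - a $ l) / 2 * sin \<theta> \<noteq> 0"
    using sqrt_curve_poly_gap_point(3)[OF assms] by linarith
  then show ?thesis
    unfolding gap_integrand_def diff_form_def sqrt_curve_poly_gap_point(1)[OF assms] by simp
qed

lemma tail_factor_pos:
  assumes "a \<in> param_space" shows "1 - a $ k * cos \<phi> > 0" 
proof -
  have "\<bar>a $ k * cos \<phi>\<bar> < 1"
    using param_spaceD(2,3)[OF assms, of k] mult_right_le_one_le[of "\<bar>a $ k\<bar>" "\<bar>cos \<phi>\<bar>"] 
    by (simp add: abs_mult)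
  then show ?thesis by linarith
qed

lemma tail_prod_pos:
  assumes "a \<in> param_space" shows "(\<Prod>k\<in>S. 1 - a $ k * cos \<phi>) > 0"
  by (intro prod_pos ballI tail_factor_pos assms)

lemma poly_at_infinity_eq:
  assumes "degree q \<le> d" "s \<noteq> 0"
  shows "poly_at_infinity d q s = s ^ d * poly q (1 / s)"
proof -
  have "poly q (1 / s) = (\<Sum>i\<le>d. coeff q i * (1 / s) ^ i)"
    unfolding poly_altdef using assms(1)
    by (intro sum.mono_neutral_left) (auto simp: coeff_eq_0)
  then show ?thesis
    using assms(2) by (auto simp: poly_at_infinity_def sum_distrib_left power_diff field_simps intro!: sum.cong)
qed

lemma tail_integrand_eq:
  fixes a :: "real ^ 'n::{finite,linorder}"
  assumes a: "a \<in> param_space" and deg: "degree q \<le> d" and card: "CARD('n) = 2 * (d + 1)"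
    and \<phi>: "0 < \<phi>" "\<phi> < pi / 2"
  shows "tail_integrand d q a \<phi> = sin \<phi> / (cos \<phi>)\<^sup>2 * diff_form q a (1 / cos \<phi>)"
    and "curve_poly a (1 / cos \<phi>) > 0"
    and "sqrt (curve_poly a (1 / cos \<phi>)) = sin \<phi> * sqrt (\<Prod>k\<in>UNIV. 1 - a $ k * cos \<phi>) / cos \<phi> ^ (d + 2)"
proof -
  define s where "s = cos \<phi>"
  define K where "K = (\<Prod>k\<in>UNIV. 1 - a $ k * s)"
  have s: "s > 0" using \<phi> by (simp add: s_def cos_gt_zero)
  have sin: "sin \<phi> > 0" using \<phi> by (simp add: sin_gt_zero)
  have pow: "(s ^ (d + 2))\<^sup>2 = s\<^sup>2 * s ^ (2 * (d + 1))"
    unfolding power_mult[symmetric] power_add[symmetric] by (rule arg_cong[where f = "\<lambda>n. s ^ n"]) simp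
  have K: "K > 0" unfolding K_def s_def by (rule tail_prod_pos[OF a])
  have "(\<Prod>k\<in>UNIV. 1 / s - a $ k) = (\<Prod>k\<in>UNIV. (1 - a $ k * s) / s)"
    using s by (intro prod.cong) (auto simp: field_simps)
  also have "\<dots> = K / s ^ (2 * (d + 1))"
    by (simp add: prod_dividef K_def card)
  finally have "curve_poly a (1 / s) = (1 - s\<^sup>2) / s\<^sup>2 * (K / s ^ (2 * (d + 1)))"
    using s by (simp add: curve_poly_def diff_divide_distrib power_divide)
  also have "1 - s\<^sup>2 = (sin \<phi>)\<^sup>2"
    by (simp add: s_def sin_squared_eq)
  finally have f: "curve_poly a (1 / s) = (sin \<phi> / s ^ (d + 2))\<^sup>2 * K"
    unfolding power_divide pow by (simp only: times_divide_eq_left times_divide_eq_right divide_divide_eq_left mult_ac)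
  then have rf: "sqrt (curve_poly a (1 / s)) = sin \<phi> * sqrt K / s ^ (d + 2)"
    using s sin by (simp add: real_sqrt_mult)
  show "curve_poly a (1 / cos \<phi>) > 0"
    unfolding s_def[symmetric] f using s sin K by simp
  show "sqrt (curve_poly a (1 / cos \<phi>)) = sin \<phi> * sqrt (\<Prod>k\<in>UNIV. 1 - a $ k * cos \<phi>) / cos \<phi> ^ (d + 2)"
    using rf unfolding s_def K_def .
  show "tail_integrand d q a \<phi> = sin \<phi> / (cos \<phi>)\<^sup>2 * diff_form q a (1 / cos \<phi>)"
    unfolding tail_integrand_def s_def[symmetric] K_def[symmetric] diff_form_def rf
      poly_at_infinity_eq[OF deg less_imp_neq[OF s, symmetric]]
    using s sin K unfolding power_add by (simp add: divide_simps del: power_Suc)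
qed

section \<open>Differentiability of the periods\<close>

text \<open>
  Leibniz' rule with a derivative given pointwise as a linear map; in finite dimension, continuity
  in the operator norm reduces to continuity in each fixed direction.
\<close>
lemma has_derivative_parametric_integral:
  fixes F :: "'a::euclidean_space \<Rightarrow> real \<Rightarrow> real" and F' :: "'a \<Rightarrow> real \<Rightarrow> 'a \<Rightarrow> real"
  assumes der: "\<And>x t. x \<in> U \<Longrightarrow> ((\<lambda>x. F x t) has_derivative F' x t) (at x)"
    and cont': "\<And>w. continuous_on (U \<times> UNIV) (\<lambda>(x, t). F' x t w)"
    and cont: "\<And>x. x \<in> U \<Longrightarrow> continuous_on {c..d} (F x)"
    and U: "open U" "convex U" "x0 \<in> U"
  shows "((\<lambda>x. integral {c..d} (F x)) has_derivative (\<lambda>w. integral {c..d} (\<lambda>t. F' x0 t w))) (at x0)"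
proof -
  define B where "B x t = Blinfun (F' x t)" for x t
  have B: "blinfun_apply (B x t) = F' x t" if "x \<in> U" for x t
    unfolding B_def using der[OF that] by (intro bounded_linear_Blinfun_apply has_derivative_bounded_linear)
  have contB: "continuous_on (U \<times> cbox c d) (\<lambda>(x, t). B x t)"
  proof (rule continuous_on_blinfun_componentwise)
    fix i :: 'a
    have "continuous_on (U \<times> cbox c d) (\<lambda>(x, t). F' x t i)"
      by (rule continuous_on_subset[OF cont']) auto
    then show "continuous_on (U \<times> cbox c d) (\<lambda>z. blinfun_apply (case z of (x, t) \<Rightarrow> B x t) i)"
      by (rule continuous_on_eq) (auto simp: B)
  qed
  have "((\<lambda>x. integral (cbox c d) (F x)) has_derivative blinfun_apply (integral (cbox c d) (B x0))) (at x0 within U)"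
    using U der cont contB
    by (intro leibniz_rule) (auto simp: B intro: has_derivative_at_withinI integrable_continuous_real)
  moreover have "(\<lambda>t. B x0 t) integrable_on cbox c d"
  proof (rule integrable_continuous)
    have "continuous_on (cbox c d) (\<lambda>t. (\<lambda>(x, t). B x t) (x0, t))"
      using U(3) by (intro continuous_on_compose2[OF contB] continuous_intros) auto
    then show "continuous_on (cbox c d) (B x0)" by simp
  qed
  then have "blinfun_apply (integral (cbox c d) (B x0)) = (\<lambda>w. integral {c..d} (\<lambda>t. F' x0 t w))"
    using B[OF U(3)] by (auto simp: blinfun_apply_integral)
  ultimately show ?thesis
    using at_within_open[OF U(3,1)] by simp
qed

lemma has_derivative_poly_compose:
  fixes f :: "'a::real_normed_vector \<Rightarrow> real"
  assumes "(f has_derivative f') (at x)"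
  shows "((\<lambda>x. poly p (f x)) has_derivative (\<lambda>w. poly (pderiv p) (f x) * f' w)) (at x)"
  using DERIV_compose_FDERIV[OF poly_DERIV assms] by (simp add: mult.commute)

lemma has_derivative_div_sqrt:
  fixes N K :: "'a::real_normed_vector \<Rightarrow> real"
  assumes "(N has_derivative N') (at x)" "(K has_derivative K') (at x)" "K x > 0"
  shows "((\<lambda>x. N x / sqrt (K x)) has_derivative
    (\<lambda>w. N' w / sqrt (K x) - N x * K' w / (2 * K x * sqrt (K x)))) (at x)"
proof -
  have "((\<lambda>x. N x / sqrt (K x)) has_derivative (\<lambda>w. (N' w * sqrt (K x) - N x * (K' w * (inverse (sqrt (K x)) / 2)))
      / (sqrt (K x) * sqrt (K x)))) (at x)"
    using assms(3)
    by (auto intro!: derivative_eq_intros assms(1,2) simp: field_simps)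
  also have "(\<lambda>w. (N' w * sqrt (K x) - N x * (K' w * (inverse (sqrt (K x)) / 2))) / (sqrt (K x) * sqrt (K x))) =
     (\<lambda>w. N' w / sqrt (K x) - N x * K' w / (2 * K x * sqrt (K x)))"
    using assms(3) by (auto simp: fun_eq_iff field_simps)
  finally show ?thesis .
qed

definition gap_cofactor_deriv :: "'n \<Rightarrow> 'n \<Rightarrow> real ^ 'n::finite \<Rightarrow> real \<Rightarrow> real ^ 'n \<Rightarrow> real" where
  "gap_cofactor_deriv l r a \<theta> w =
    (1 - (gap_point l r a \<theta>)\<^sup>2) * (\<Sum>k\<in>-{l, r}. (gap_point l r w \<theta> - w $ k) *
        (\<Prod>j\<in>-{l, r} - {k}. gap_point l r a \<theta> - a $ j))
    - 2 * gap_point l r w \<theta> * gap_point l r a \<theta> * (\<Prod>k\<in>-{l, r}. gap_point l r a \<theta> - a $ k)"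

definition gap_integrand_deriv :: "'n \<Rightarrow> 'n \<Rightarrow> real poly \<Rightarrow> real ^ 'n::finite \<Rightarrow> real \<Rightarrow> real ^ 'n \<Rightarrow> real" where
  "gap_integrand_deriv l r q a \<theta> w =
    poly (pderiv q) (gap_point l r a \<theta>) * gap_point l r w \<theta> / sqrt (gap_cofactor l r a (gap_point l r a \<theta>))
    - poly q (gap_point l r a \<theta>) * gap_cofactor_deriv l r a \<theta> w
       / (2 * gap_cofactor l r a (gap_point l r a \<theta>) * sqrt (gap_cofactor l r a (gap_point l r a \<theta>)))"

lemma has_derivative_vec_nth: "((\<lambda>x. x $ k) has_derivative (\<lambda>w. w $ k)) F"
  by (rule bounded_linear_imp_has_derivative[OF bounded_linear_vec_nth])

lemma has_derivative_gap_point: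
  "((\<lambda>a. gap_point l r a \<theta>) has_derivative (\<lambda>w. gap_point l r w \<theta>)) (at a)"
  unfolding gap_point_def
  by (auto intro!: derivative_eq_intros has_derivative_vec_nth simp: fun_eq_iff field_simps)

lemma has_derivative_gap_integrand:
  assumes "a \<in> param_space" "is_gap l r"
  shows "((\<lambda>a. gap_integrand l r q a \<theta>) has_derivative gap_integrand_deriv l r q a \<theta>) (at a)"
  unfolding gap_integrand_def gap_integrand_deriv_def[abs_def]
proof (intro has_derivative_div_sqrt has_derivative_poly_compose has_derivative_gap_point)
  show "((\<lambda>a. gap_cofactor l r a (gap_point l r a \<theta>)) has_derivative gap_cofactor_deriv l r a \<theta>) (at a)"
    unfolding gap_cofactor_def gap_cofactor_deriv_def[abs_def]
    by (auto intro!: derivative_eq_intros has_derivative_gap_point has_derivative_vec_nth simp: fun_eq_iff)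
qed (rule gap_cofactor_point_pos[OF assms])

lemma continuous_on_gap_point [continuous_intros]:
  fixes f :: "'a::t2_space \<Rightarrow> real ^ 'n::finite"
  shows "continuous_on S f \<Longrightarrow> continuous_on S h \<Longrightarrow> continuous_on S (\<lambda>x. gap_point l r (f x) (h x))"
  unfolding gap_point_def by (intro continuous_intros) auto

lemma continuous_on_gap_cofactor [continuous_intros]:
  fixes f :: "'a::t2_space \<Rightarrow> real ^ 'n::finite"
  shows "continuous_on S f \<Longrightarrow> continuous_on S h \<Longrightarrow> continuous_on S (\<lambda>x. gap_cofactor l r (f x) (h x))"
  unfolding gap_cofactor_def by (intro continuous_intros)

lemma continuous_on_gap_integrand:
  assumes "a \<in> param_space" "is_gap l r"
  shows "continuous_on S (gap_integrand l r q a)"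
  unfolding gap_integrand_def[abs_def]
  using gap_cofactor_point_pos[OF assms] by (intro continuous_intros) (simp add: less_imp_neq[symmetric])

lemma continuous_on_gap_integrand_deriv:
  assumes "is_gap l r"
  shows "continuous_on (param_space \<times> UNIV) (\<lambda>(a, \<theta>). gap_integrand_deriv l r q a \<theta> w)"
  unfolding gap_integrand_deriv_def gap_cofactor_deriv_def case_prod_beta
  using gap_cofactor_point_pos[OF _ assms] by (intro continuous_intros) (auto simp: less_imp_neq[symmetric])

definition gap_integral :: "'n \<Rightarrow> 'n \<Rightarrow> real poly \<Rightarrow> real ^ 'n::finite \<Rightarrow> real"
  where "gap_integral l r q a = integral {0..pi} (gap_integrand l r q a)"

definition tail_integral :: "nat \<Rightarrow> real poly \<Rightarrow> real ^ 'n::finite \<Rightarrow> real"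
  where "tail_integral d q a = integral {0..pi/2} (tail_integrand d q a)"

lemma has_derivative_gap_integral:
  assumes "a \<in> param_space" "is_gap l r"
  shows "(gap_integral l r q has_derivative (\<lambda>w. integral {0..pi} (\<lambda>\<theta>. gap_integrand_deriv l r q a \<theta> w))) (at a)"
  unfolding gap_integral_def[abs_def]
  by (rule has_derivative_parametric_integral[where U = param_space])
    (auto intro: assms has_derivative_gap_integrand continuous_on_gap_integrand
      continuous_on_gap_integrand_deriv open_param_space convex_param_space)

definition tail_integrand_deriv :: "nat \<Rightarrow> real poly \<Rightarrow> real ^ 'n::finite \<Rightarrow> real \<Rightarrow> real ^ 'n \<Rightarrow> real" where
  "tail_integrand_deriv d q a \<phi> w = - poly_at_infinity d q (cos \<phi>) *
     (\<Sum>k\<in>UNIV. - (w $ k * cos \<phi>) * (\<Prod>j\<in>UNIV - {k}. 1 - a $ j * cos \<phi>)) /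
     (2 * (\<Prod>k\<in>UNIV. 1 - a $ k * cos \<phi>) * sqrt (\<Prod>k\<in>UNIV. 1 - a $ k * cos \<phi>))"

lemma has_derivative_tail_integrand:
  assumes "a \<in> param_space"
  shows "((\<lambda>a. tail_integrand d q a \<phi>) has_derivative tail_integrand_deriv d q a \<phi>) (at a)"
proof -
  have "((\<lambda>a. tail_integrand d q a \<phi>) has_derivative (\<lambda>w. 0 / sqrt (\<Prod>k\<in>UNIV. 1 - a $ k * cos \<phi>) -
     poly_at_infinity d q (cos \<phi>) * (\<Sum>k\<in>UNIV. - (w $ k * cos \<phi>) * (\<Prod>j\<in>UNIV - {k}. 1 - a $ j * cos \<phi>)) /
     (2 * (\<Prod>k\<in>UNIV. 1 - a $ k * cos \<phi>) * sqrt (\<Prod>k\<in>UNIV. 1 - a $ k * cos \<phi>)))) (at a)"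
    unfolding tail_integrand_def
    using tail_prod_pos[OF assms]
    by (intro has_derivative_div_sqrt) (auto intro!: derivative_eq_intros has_derivative_vec_nth)
  then show ?thesis by (simp add: tail_integrand_deriv_def[abs_def])
qed

lemma continuous_on_poly_at_infinity [continuous_intros]:
  "continuous_on S f \<Longrightarrow> continuous_on S (\<lambda>x. poly_at_infinity d q (f x))"
  unfolding poly_at_infinity_def by (intro continuous_intros)

lemma continuous_on_tail_integrand:
  assumes "a \<in> param_space"
  shows "continuous_on S (tail_integrand d q a)"
  unfolding tail_integrand_def[abs_def]
  using tail_prod_pos[OF assms] by (intro continuous_intros) (simp add: less_imp_neq[symmetric])

lemma continuous_on_tail_integrand_deriv:
  "continuous_on (param_space \<times> UNIV) (\<lambda>(a, \<phi>). tail_integrand_deriv d q a \<phi> w)"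
proof -
  have "(\<Prod>k\<in>UNIV. 1 - fst z $ k * cos (snd z)) \<noteq> 0" if "z \<in> param_space \<times> UNIV" for z :: "(real, 'a) vec \<times> real"
    using tail_prod_pos[of "fst z" "snd z" UNIV] that by (auto simp del: prod_zero_iff)
  then show ?thesis
    unfolding tail_integrand_deriv_def case_prod_beta
    by (intro continuous_intros) (simp_all del: prod_zero_iff)
qed

lemma has_derivative_tail_integral:
  assumes "a \<in> param_space"
  shows "(tail_integral d q has_derivative (\<lambda>w. integral {0..pi/2} (\<lambda>\<phi>. tail_integrand_deriv d q a \<phi> w))) (at a)"
  unfolding tail_integral_def[abs_def]
  by (rule has_derivative_parametric_integral[where U = param_space])
    (auto intro: assms has_derivative_tail_integrand continuous_on_tail_integrand
      continuous_on_tail_integrand_deriv open_param_space convex_param_space)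

section \<open>The variation of the integrands is exact up to a regular differential\<close>

text \<open>
  The polynomial \<open>B\<close>, vanishing at \<open>1\<close>, at \<open>-1\<close> and at the branch points with index outside \<open>A\<close>.
\<close>
definition branch_poly :: "'n set \<Rightarrow> real ^ 'n::finite \<Rightarrow> real poly"
  where "branch_poly A a = [:-1, 0, 1:] * (\<Prod>k\<in>-A. [:- (a $ k), 1:])"

text \<open>
  The polynomial \<open>Q\<close> for which the variation of \<open>q / sqrt f\<close> equals \<open>Q / sqrt f\<close> up to an exact term. The
  divisions are exact for the velocities \<open>u\<close> considered below.
\<close>
definition variation_numerator :: "'n set \<Rightarrow> real ^ 'n::finite \<Rightarrow> real ^ 'n \<Rightarrow> real poly \<Rightarrow> real poly"
  where "variation_numerator A a u q =
    smult (1/2) (pderiv (branch_poly A a) - (\<Sum>k\<in>A. (branch_poly A a - smult (u $ k) q) div [:- (a $ k), 1:]))"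

text \<open>
  The condition \<open>u\<^sub>k q(a\<^sub>k) = B(a\<^sub>k)\<close> matches the pole of the formal variation at \<open>a\<^sub>k\<close> with that of the
  derivative of \<open>- B / sqrt f\<close>. Outside \<open>A\<close> both sides vanish, which allows one formula for all indices.
\<close>
definition normalized_velocity :: "'n set \<Rightarrow> real ^ 'n::finite \<Rightarrow> real ^ 'n \<Rightarrow> real poly \<Rightarrow> bool"
  where "normalized_velocity A a u q \<longleftrightarrow> (\<forall>k. u $ k * poly q (a $ k) = poly (branch_poly A a) (a $ k)) \<and> (\<forall>k\<in>-A. u $ k = 0)"

lemma poly_branch_poly: "poly (branch_poly A a) x = (x\<^sup>2 - 1) * (\<Prod>k\<in>-A. x - a $ k)"
  by (simp add: branch_poly_def poly_prod power2_eq_square left_diff_distrib)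

text \<open>
  Simultaneous motion of the branch points, with velocity \<open>u\<close>, and of the point at which the curve
  polynomial is evaluated, with velocity \<open>\<xi>\<close>: each factor contributes its logarithmic derivative.
\<close>
lemma DERIV_curve_poly_path:
  assumes X: "(X has_real_derivative \<xi>) (at 0)" and nz: "curve_poly a (X 0) \<noteq> 0"
  shows "((\<lambda>t. curve_poly (a + t *\<^sub>R u) (X t)) has_real_derivative
    curve_poly a (X 0) * (2 * X 0 * \<xi> / ((X 0)\<^sup>2 - 1) + (\<Sum>k\<in>UNIV. (\<xi> - u $ k) / (X 0 - a $ k)))) (at 0)"
proof -
  define x where "x = X 0"
  have nz': "x\<^sup>2 - 1 \<noteq> 0" "x - a $ k \<noteq> 0" for k
    using nz by (auto simp: curve_poly_def x_def)
  have "((\<lambda>t. \<Prod>k\<in>UNIV. X t - (a + t *\<^sub>R u) $ k) has_real_derivative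
    (\<Prod>k\<in>UNIV. X 0 - (a + 0 *\<^sub>R u) $ k) * (\<Sum>k\<in>UNIV. (\<xi> - u $ k) / (X 0 - (a + 0 *\<^sub>R u) $ k))) (at 0)"
    using nz' by (intro has_field_derivative_prod') (auto intro!: derivative_eq_intros X simp: x_def)
  then have D: "((\<lambda>t. \<Prod>k\<in>UNIV. X t - (a $ k + t * u $ k)) has_real_derivative
    (\<Prod>k\<in>UNIV. x - a $ k) * (\<Sum>k\<in>UNIV. (\<xi> - u $ k) / (x - a $ k))) (at 0)"
    by (simp add: x_def)
  have "((\<lambda>t. curve_poly (a + t *\<^sub>R u) (X t)) has_real_derivative
      (2 * x * \<xi>) * (\<Prod>k\<in>UNIV. x - a $ k) + 
      (x\<^sup>2 - 1) * ((\<Prod>k\<in>UNIV. x - a $ k) * (\<Sum>k\<in>UNIV. (\<xi> - u $ k) / (x - a $ k)))) (at 0)"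
    by (auto intro!: derivative_eq_intros X D simp: curve_poly_def x_def)
  also have "(2 * x * \<xi>) * (\<Prod>k\<in>UNIV. x - a $ k) + 
      (x\<^sup>2 - 1) * ((\<Prod>k\<in>UNIV. x - a $ k) * (\<Sum>k\<in>UNIV. (\<xi> - u $ k) / (x - a $ k))) =
      curve_poly a x * (2 * x * \<xi> / (x\<^sup>2 - 1) + (\<Sum>k\<in>UNIV. (\<xi> - u $ k) / (x - a $ k)))"
    using nz'(1) by (simp add: curve_poly_def field_simps)
  finally show ?thesis by (simp add: x_def)
qed

definition curve_log_deriv :: "real ^ 'n::finite \<Rightarrow> real \<Rightarrow> real"
  where "curve_log_deriv a x = 2 * x / (x\<^sup>2 - 1) + (\<Sum>k\<in>UNIV. 1 / (x - a $ k))"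

lemma variation_numerator_dvd:
  assumes "normalized_velocity A a u q"
  shows "[:- (a $ k), 1:] * ((branch_poly A a - smult (u $ k) q) div [:- (a $ k), 1:]) =
    branch_poly A a - smult (u $ k) q"
proof (rule dvd_mult_div_cancel)
  show "[:- (a $ k), 1:] dvd branch_poly A a - smult (u $ k) q"
    using assms by (simp add: normalized_velocity_def flip: poly_eq_0_iff_dvd)
qed

text \<open>
  The algebraic heart of the argument. Both sides are \<open>sqrt f\<close> times the derivative of \<open>B / sqrt f\<close>;
  the right-hand side separates its polynomial part \<open>Q\<close> from the formal variation of \<open>q / sqrt f\<close>. The
  logarithmic derivative of \<open>f\<close> contributes \<open>1 / (x - a\<^sub>k)\<close> for every \<open>k\<close>; the indices outside \<open>A\<close> combine with
  the derivative of \<open>B\<close>, and those in \<open>A\<close> produce the quotients in \<open>Q\<close>.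
\<close>
lemma variation_identity:
  assumes adm: "normalized_velocity A a u q" and nz: "curve_poly a x \<noteq> 0"
  shows "poly (pderiv (branch_poly A a)) x - poly (branch_poly A a) x * curve_log_deriv a x / 2 =
    poly (variation_numerator A a u q) x - poly q x * (\<Sum>k\<in>UNIV. u $ k / (x - a $ k)) / 2"
proof -
  let ?B = "branch_poly A a"
  define T where "T = 2 * x / (x\<^sup>2 - 1)"
  have nz': "x\<^sup>2 - 1 \<noteq> 0" "x - a $ k \<noteq> 0" for k
    using nz by (auto simp: curve_poly_def)
  have "((\<lambda>x. (x\<^sup>2 - 1) * (\<Prod>k\<in>-A. x - a $ k)) has_real_derivative
      2 * x * (\<Prod>k\<in>-A. x - a $ k) + (x\<^sup>2 - 1) * ((\<Prod>k\<in>-A. x - a $ k) * (\<Sum>k\<in>-A. 1 / (x - a $ k)))) (at x)"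
    using nz' by (auto intro!: derivative_eq_intros has_field_derivative_prod')
  then have "poly (pderiv ?B) x = 
      2 * x * (\<Prod>k\<in>-A. x - a $ k) + (x\<^sup>2 - 1) * ((\<Prod>k\<in>-A. x - a $ k) * (\<Sum>k\<in>-A. 1 / (x - a $ k)))"
    using poly_DERIV[of ?B x] unfolding poly_branch_poly[abs_def] by (rule DERIV_unique[rotated])
  also have "\<dots> = poly ?B x * (2 * x / (x\<^sup>2 - 1) + (\<Sum>k\<in>-A. 1 / (x - a $ k)))"
    using nz'(1) by (simp add: poly_branch_poly field_simps)
  finally have B': "poly (pderiv ?B) x = poly ?B x * (T + (\<Sum>k\<in>-A. 1 / (x - a $ k)))"
    unfolding T_def .
  have quot: "poly ((?B - smult (u $ k) q) div [:- (a $ k), 1:]) x = 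
      (poly ?B x - u $ k * poly q x) / (x - a $ k)" for k
    using arg_cong[OF variation_numerator_dvd[OF adm, of k], of "\<lambda>p. poly p x"] nz'(2)[of k]
    by (simp add: field_simps)
  have split: "sum h UNIV = sum h A + sum h (-A)" for h :: "'a \<Rightarrow> real"
    by (metis Compl_eq_Diff_UNIV finite sum.subset_diff add.commute subset_UNIV)
  have "(\<Sum>k\<in>UNIV. u $ k / (x - a $ k)) = (\<Sum>k\<in>A. u $ k / (x - a $ k))"
    using adm by (simp add: split normalized_velocity_def)
  moreover have "curve_log_deriv a x = T + (\<Sum>k\<in>A. 1 / (x - a $ k)) + (\<Sum>k\<in>-A. 1 / (x - a $ k))"
    by (simp add: curve_log_deriv_def T_def split)
  moreover have "poly (variation_numerator A a u q) x = 
     (poly (pderiv ?B) x - (\<Sum>k\<in>A. (poly ?B x - u $ k * poly q x) / (x - a $ k))) / 2"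
    by (simp add: variation_numerator_def poly_sum quot)
  moreover have "(\<Sum>k\<in>A. (poly ?B x - u $ k * poly q x) / (x - a $ k)) =
      poly ?B x * (\<Sum>k\<in>A. 1 / (x - a $ k)) - poly q x * (\<Sum>k\<in>A. u $ k / (x - a $ k))"
    by (simp add: sum_distrib_left sum_subtractf diff_divide_distrib mult_ac)
  ultimately show ?thesis
    unfolding B' by (simp only:) (simp add: algebra_simps)
qed

lemma coeff_linear_mult: "coeff ([:- c, 1:] * R) (Suc n) = coeff R n - c * coeff R (Suc n)"
  for R :: "real poly"
  by simp

text \<open>
  The derivative of \<open>B\<close> has leading term \<open>(d + 2) x\<^sup>d\<^sup>+\<^sup>1\<close>, and each of the \<open>d + 2\<close> quotients is monic of degree \<open>d + 1\<close>,
  so the leading terms cancel. This is why \<open>A\<close> must contain exactly half of the \<open>2 d + 4\<close> finite branch points.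
\<close>
lemma degree_variation_numerator:
  fixes a :: "real ^ 'n::finite"
  assumes adm: "normalized_velocity A a u q" and deg: "degree q \<le> d" and card: "card A = d + 2" "CARD('n) = 2 * (d + 1)"
  shows "degree (variation_numerator A a u q) \<le> d"
proof -
  let ?B = "branch_poly A a"
  define R where "R k = (?B - smult (u $ k) q) div [:- (a $ k), 1:]" for k
  have R: "[:- (a $ k), 1:] * R k = ?B - smult (u $ k) q" for k
    unfolding R_def by (rule variation_numerator_dvd[OF adm])
  have cardc: "card (-A) = d"
    using card by (simp add: Compl_eq_Diff_UNIV card_Diff_subset)
  have lead: "lead_coeff (\<Prod>k\<in>-A. [:- (a $ k), 1:]) = 1"
    by (simp add: lead_coeff_prod)
  have degp: "degree (\<Prod>k\<in>-A. [:- (a $ k), 1:]) = d"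
    by (subst degree_prod_sum_eq) (auto simp: cardc)
  have degB: "degree ?B = d + 2"
    unfolding branch_poly_def using lead by (subst degree_mult_eq) (auto simp: degp)
  have leadB: "coeff ?B (d + 2) = 1"
  proof -
    have "lead_coeff ?B = 1" unfolding branch_poly_def lead_coeff_mult lead by simp
    then show ?thesis unfolding degB .
  qed
  have degR: "degree (R k) \<le> d + 1" for k
  proof (cases "R k = 0")
    case False
    then have "degree ([:- (a $ k), 1:] * R k) = 1 + degree (R k)"
      by (subst degree_mult_eq) auto
    moreover have "degree (?B - smult (u $ k) q) \<le> d + 2"
      using degB deg by (intro degree_diff_le) (auto intro: order.trans[OF degree_smult_le])
    ultimately show ?thesis unfolding R by linarith
  qed auto
  have leadR: "coeff (R k) (d + 1) = 1" for k
  proof -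
    have "coeff ([:- (a $ k), 1:] * R k) (Suc (d + 1)) = 1"
      unfolding R using leadB deg by (simp add: coeff_eq_0)
    then show ?thesis
      unfolding coeff_linear_mult using degR[of k] by (simp add: coeff_eq_0)
  qed
  have "coeff (variation_numerator A a u q) i = 0" if "i > d" for i
  proof -
    have "coeff (variation_numerator A a u q) i = (real (Suc i) * coeff ?B (Suc i) - (\<Sum>k\<in>A. coeff (R k) i)) / 2"
      by (simp add: variation_numerator_def R_def coeff_sum coeff_pderiv)
    also have "\<dots> = 0"
    proof (cases "i = d + 1")
      case True
      then show ?thesis using leadB leadR card by simp
    next
      case False
      then have "coeff ?B (Suc i) = 0" "coeff (R k) i = 0" for k
        using degB degR[of k] that by (auto intro!: coeff_eq_0)
      then show ?thesis by simp
    qed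
    finally show ?thesis .
  qed
  then show ?thesis by (intro degree_le) auto
qed

text \<open>
  The variation of an integrand after substitution: \<open>X\<close> is the moving point and \<open>Y\<close> the Jacobian factor of the
  substitution, both at a fixed value of the integration variable.
\<close>
lemma DERIV_over_sqrt_curve:
  assumes X: "(X has_real_derivative \<xi>) (at 0)" and Y: "(Y has_real_derivative \<eta>) (at 0)"
    and pos: "curve_poly a (X 0) > 0"
  shows "((\<lambda>t. Y t * diff_form q (a + t *\<^sub>R u) (X t)) has_real_derivative
    (\<eta> * poly q (X 0) + Y 0 * (poly (pderiv q) (X 0) * \<xi>
       - poly q (X 0) * (\<xi> * curve_log_deriv a (X 0) - (\<Sum>k\<in>UNIV. u $ k / (X 0 - a $ k))) / 2))
      / sqrt (curve_poly a (X 0))) (at 0)"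
proof -
  let ?f = "curve_poly a (X 0)"
  define L where "L = \<xi> * curve_log_deriv a (X 0) - (\<Sum>k\<in>UNIV. u $ k / (X 0 - a $ k))"
  have "((\<lambda>t. curve_poly (a + t *\<^sub>R u) (X t)) has_real_derivative ?f * L) (at 0)"
    using DERIV_curve_poly_path[OF X, of a u] pos
    by (simp add: L_def curve_log_deriv_def diff_divide_distrib sum_subtractf sum_distrib_left algebra_simps)
  then have f: "((\<lambda>t. sqrt (curve_poly (a + t *\<^sub>R u) (X t))) has_real_derivative
      ?f * L * (inverse (sqrt ?f) / 2)) (at 0)"
    using pos by (auto intro!: derivative_eq_intros)
  have q: "((\<lambda>t. poly q (X t)) has_real_derivative poly (pderiv q) (X 0) * \<xi>) (at 0)"
    by (rule DERIV_chain2[OF poly_DERIV X])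
  have "((\<lambda>t. Y t * diff_form q (a + t *\<^sub>R u) (X t)) has_real_derivative
     \<eta> * (poly q (X 0) / sqrt ?f) + 
     (poly (pderiv q) (X 0) * \<xi> * sqrt ?f - poly q (X 0) * (?f * L * (inverse (sqrt ?f) / 2))) /
      (sqrt ?f * sqrt ?f) * Y 0) (at 0)"
    unfolding diff_form_def
    by (rule derivative_eq_intros Y q f refl | use pos in simp)+
  also have "\<eta> * (poly q (X 0) / sqrt ?f) + 
     (poly (pderiv q) (X 0) * \<xi> * sqrt ?f - poly q (X 0) * (?f * L * (inverse (sqrt ?f) / 2))) /
      (sqrt ?f * sqrt ?f) * Y 0 = 
     (\<eta> * poly q (X 0) + Y 0 * (poly (pderiv q) (X 0) * \<xi> - poly q (X 0) * L / 2)) / sqrt ?f"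
    using pos by (simp add: field_simps)
  finally show ?thesis by (simp add: L_def)
qed

lemma DERIV_diff_form:
  assumes pos: "curve_poly a x > 0"
  shows "(diff_form N a has_real_derivative
    (poly (pderiv N) x - poly N x * curve_log_deriv a x / 2) / sqrt (curve_poly a x)) (at x)"
proof -
  have "((\<lambda>t. 1 * diff_form N (a + t *\<^sub>R 0) (x + t)) has_real_derivative
    (0 * poly N (x + 0) + 1 * (poly (pderiv N) (x + 0) * 1
       - poly N (x + 0) * (1 * curve_log_deriv a (x + 0) - (\<Sum>k\<in>UNIV. 0 $ k / (x + 0 - a $ k))) / 2))
      / sqrt (curve_poly a (x + 0))) (at 0)"
    using pos by (intro DERIV_over_sqrt_curve) (auto intro!: derivative_eq_intros)
  then show ?thesis
    using DERIV_shift[of "diff_form N a" _ 0 x] by (simp add: add.commute)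
qed

section \<open>Variation of the periods\<close>

lemma has_derivative_imp_DERIV_line:
  fixes F :: "'a::real_normed_vector \<Rightarrow> real"
  assumes "(F has_derivative F') (at a)"
  shows "((\<lambda>t. F (a + t *\<^sub>R u)) has_real_derivative F' u) (at 0)"
proof -
  have "((\<lambda>t. a + t *\<^sub>R u) has_derivative (\<lambda>t. t *\<^sub>R u)) (at 0)"
    by (auto intro!: derivative_eq_intros)
  then have "((\<lambda>t. F (a + t *\<^sub>R u)) has_derivative (\<lambda>t. F' (t *\<^sub>R u))) (at 0)"
    using assms by (intro has_derivative_compose[where g = F and f = "\<lambda>t. a + t *\<^sub>R u"]) auto
  also have "(\<lambda>t. F' (t *\<^sub>R u)) = (*) (F' u)"
    using linear_scale[OF has_derivative_linear[OF assms]] by (auto simp: fun_eq_iff)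
  finally show ?thesis by (simp add: has_field_derivative_def)
qed

lemma eventually_line_in_param_space:
  assumes "a \<in> param_space"
  shows "\<forall>\<^sub>F t in nhds 0. a + t *\<^sub>R u \<in> param_space"
proof -
  have "((\<lambda>t. a + t *\<^sub>R u) \<longlongrightarrow> a + 0 *\<^sub>R u) (nhds 0)"
    by (intro tendsto_intros) (simp add: filterlim_ident)
  then show ?thesis
    using topological_tendstoD[OF _ open_param_space, of _ a] assms by simp
qed

lemma gap_integrand_deriv_eq:
  fixes a u :: "real ^ 'n::{finite,linorder}"
  assumes a: "a \<in> param_space" and gap: "is_gap l r" and \<theta>: "0 < \<theta>" "\<theta> < pi"
  defines "y \<equiv> gap_point l r a \<theta>" and "\<xi> \<equiv> gap_point l r u \<theta>"
  shows "gap_integrand_deriv l r q a \<theta> u =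
    ((u $ r - u $ l) / 2 * sin \<theta> * poly q y + (a $ r - a $ l) / 2 * sin \<theta> * (poly (pderiv q) y * \<xi>
       - poly q y * (\<xi> * curve_log_deriv a y - (\<Sum>k\<in>UNIV. u $ k / (y - a $ k))) / 2)) / sqrt (curve_poly a y)"
proof -
  let ?X = "\<lambda>t. gap_point l r (a + t *\<^sub>R u) \<theta>"
  let ?Y = "\<lambda>t. ((a + t *\<^sub>R u) $ r - (a + t *\<^sub>R u) $ l) / 2 * sin \<theta>"
  have "((\<lambda>t. gap_integrand l r q (a + t *\<^sub>R u) \<theta>) has_real_derivative gap_integrand_deriv l r q a \<theta> u) (at 0)"
    by (rule has_derivative_imp_DERIV_line[OF has_derivative_gap_integrand[OF a gap]])
  moreover have "\<forall>\<^sub>F t in nhds 0. gap_integrand l r q (a + t *\<^sub>R u) \<theta> = ?Y t * diff_form q (a + t *\<^sub>R u) (?X t)"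
    using eventually_line_in_param_space[OF a, of u]
    by eventually_elim (rule gap_integrand_eq[OF _ gap \<theta>])
  ultimately have 1: "((\<lambda>t. ?Y t * diff_form q (a + t *\<^sub>R u) (?X t)) has_real_derivative
      gap_integrand_deriv l r q a \<theta> u) (at 0)"
    by (subst DERIV_cong_ev[symmetric]) auto
  have X: "(?X has_real_derivative \<xi>) (at 0)"
    unfolding \<xi>_def by (rule has_derivative_imp_DERIV_line[OF has_derivative_gap_point])
  have Y: "(?Y has_real_derivative (u $ r - u $ l) / 2 * sin \<theta>) (at 0)"
    by (auto intro!: derivative_eq_intros)
  have "curve_poly a (?X 0) > 0"
    using sqrt_curve_poly_gap_point(2)[OF a gap \<theta>] by simp
  from DERIV_over_sqrt_curve[OF X Y this, of q u] have "((\<lambda>t. ?Y t * diff_form q (a + t *\<^sub>R u) (?X t)) has_real_derivative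
    ((u $ r - u $ l) / 2 * sin \<theta> * poly q y + (a $ r - a $ l) / 2 * sin \<theta> * (poly (pderiv q) y * \<xi>
       - poly q y * (\<xi> * curve_log_deriv a y - (\<Sum>k\<in>UNIV. u $ k / (y - a $ k))) / 2)) / sqrt (curve_poly a y)) (at 0)"
    by (simp add: y_def)
  from DERIV_unique[OF 1 this] show ?thesis .
qed

text \<open>
  The point \<open>x\<close> moves with a velocity that is affine in \<open>x\<close>, given by the polynomial \<open>X\<close>. Its motion adds the
  derivative of \<open>X q / sqrt f\<close> to the formal variation, so the total exact term is the derivative of
  \<open>(X q - B) / sqrt f\<close>. Since \<open>X\<close> interpolates \<open>u\<^sub>l\<close> and \<open>u\<^sub>r\<close>, the numerator vanishes at both ends of the gap.
  It therefore cancels the singularity of \<open>1 / sqrt f\<close>, and the boundary values are zero.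
\<close>
lemma gap_variation:
  assumes a: "a \<in> param_space" and gap: "is_gap l r" and adm: "normalized_velocity A a u q"
  shows "integral {0..pi} (\<lambda>\<theta>. gap_integrand_deriv l r q a \<theta> u) =
    gap_integral l r (variation_numerator A a u q) a"
proof -
  let ?B = "branch_poly A a" and ?Q = "variation_numerator A a u q"
  define y where "y = gap_point l r a"
  define S where "S \<theta> = (a $ r - a $ l) / 2 * sin \<theta>" for \<theta>
  define X1 where "X1 = (u $ r - u $ l) / (a $ r - a $ l)"
  define X where "X = [:u $ l - X1 * a $ l, X1:]"
  define N where "N = X * q - ?B"
  have lr: "a $ l < a $ r" using param_spaceD(1)[OF a Compl_gap(3)[OF gap]] .
  have X1: "X1 * (a $ r - a $ l) = u $ r - u $ l"
    using lr by (simp add: X1_def)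
  then have u_r: "u $ r = u $ l + X1 * (a $ r - a $ l)" by simp
  have X_y: "poly X (y \<theta>) = gap_point l r u \<theta>" for \<theta>
    unfolding X_def y_def gap_point_def u_r by (simp add: field_simps)
  have "poly X (a $ l) = u $ l" "poly X (a $ r) = u $ r"
    unfolding u_r by (auto simp: X_def algebra_simps)
  then have "poly N (a $ l) = 0" and N_r: "poly N (a $ r) = 0"
    using adm by (auto simp: N_def normalized_velocity_def)
  then obtain N0 where N0: "N = [:- (a $ l), 1:] * N0"
    unfolding poly_eq_0_iff_dvd by (auto simp only: dvd_def)
  with N_r lr have "poly N0 (a $ r) = 0" by simp
  then obtain N1 where N1': "N0 = [:- (a $ r), 1:] * N1"
    unfolding poly_eq_0_iff_dvd by (auto simp only: dvd_def)
  have N1: "poly N x = - ((x - a $ l) * (a $ r - x)) * poly N1 x" for x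
    unfolding N0 N1' by (simp add: algebra_simps)
  \<comment> \<open>The boundary term, in a form that is continuous up to the ends of the gap.\<close>
  define W where "W \<theta> = - poly N1 (y \<theta>) * S \<theta> / sqrt (gap_cofactor l r a (y \<theta>))" for \<theta>
  have W: "W \<theta> = diff_form N a (y \<theta>)" if "\<theta> \<in> {0<..<pi}" for \<theta>
  proof -
    have "S \<theta> > 0" "sqrt (curve_poly a (y \<theta>)) = S \<theta> * sqrt (gap_cofactor l r a (y \<theta>))"
      using sqrt_curve_poly_gap_point[OF a gap, of \<theta>] that by (auto simp: S_def y_def)
    moreover have "(y \<theta> - a $ l) * (a $ r - y \<theta>) = (S \<theta>)\<^sup>2"
      unfolding y_def S_def by (rule gap_point_factors)
    ultimately show ?thesis
      by (simp add: W_def diff_form_def N1 power2_eq_square)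
  qed
  have "((\<lambda>\<theta>. gap_integrand_deriv l r q a \<theta> u - gap_integrand l r ?Q a \<theta>) has_integral (W pi - W 0)) {0..pi}"
  proof (rule fundamental_theorem_of_calculus_interior)
    show "continuous_on {0..pi} W"
      unfolding W_def S_def y_def using gap_cofactor_point_pos[OF a gap]
      by (intro continuous_intros) (simp add: less_imp_neq[symmetric])
    fix \<theta> assume \<theta>: "\<theta> \<in> {0<..<pi}"
    have pos: "curve_poly a (y \<theta>) > 0"
      using sqrt_curve_poly_gap_point(2)[OF a gap, of \<theta>] \<theta> by (simp add: y_def)
    have y': "(y has_real_derivative S \<theta>) (at \<theta>)"
      unfolding y_def gap_point_def S_def by (auto intro!: derivative_eq_intros)
    let ?D = "(poly (pderiv N) (y \<theta>) - poly N (y \<theta>) * curve_log_deriv a (y \<theta>) / 2) / sqrt (curve_poly a (y \<theta>)) * S \<theta>"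
    have "((\<lambda>\<theta>. diff_form N a (y \<theta>)) has_real_derivative ?D) (at \<theta>)"
      by (rule DERIV_chain2[OF DERIV_diff_form[OF pos] y'])
    then have "(W has_real_derivative ?D) (at \<theta>)"
      by (rule has_field_derivative_transform_within_open[where S = "{0<..<pi}"]) (use \<theta> W in auto)
    moreover have "?D = gap_integrand_deriv l r q a \<theta> u - gap_integrand l r ?Q a \<theta>"
    proof -
      define \<Sigma> where "\<Sigma> = (\<Sum>k\<in>UNIV. u $ k / (y \<theta> - a $ k))"
      define L where "L = curve_log_deriv a (y \<theta>)"
      define x where "x = y \<theta>"
      have "(u $ r - u $ l) / 2 * sin \<theta> = X1 * S \<theta>"
        unfolding X1[symmetric] by (simp add: S_def)
      then have 1: "gap_integrand_deriv l r q a \<theta> u = (X1 * S \<theta> * poly q x + S \<theta> * (poly (pderiv q) x * poly X x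
         - poly q x * (poly X x * L - \<Sigma>) / 2)) / sqrt (curve_poly a x)"
        using gap_integrand_deriv_eq[OF a gap, of \<theta> q u] \<theta>
        by (simp add: X_y[unfolded y_def] x_def y_def L_def \<Sigma>_def S_def)
      have 2: "gap_integrand l r ?Q a \<theta> = S \<theta> * poly ?Q x / sqrt (curve_poly a x)"
        using gap_integrand_eq[OF a gap, of \<theta> ?Q] \<theta> by (simp add: S_def diff_form_def y_def x_def)
      have "poly (pderiv ?B) x - poly ?B x * L / 2 = poly ?Q x - poly q x * \<Sigma> / 2"
        using variation_identity[OF adm, of "y \<theta>"] pos by (simp add: L_def \<Sigma>_def x_def)
      then have Q: "poly ?Q x = poly (pderiv ?B) x - poly ?B x * L / 2 + poly q x * \<Sigma> / 2"
        by simp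
      have "poly (pderiv X) x = X1"
        by (simp add: X_def pderiv_pCons)
      then have N': "poly (pderiv N) x = X1 * poly q x + poly X x * poly (pderiv q) x - poly (pderiv ?B) x"
        by (simp add: N_def pderiv_diff pderiv_mult)
      have N: "poly N x = poly X x * poly q x - poly ?B x"
        by (simp add: N_def)
      have "?D = (poly (pderiv N) x - poly N x * L / 2) * S \<theta> / sqrt (curve_poly a x)"
        by (simp add: x_def L_def)
      also have "(poly (pderiv N) x - poly N x * L / 2) * S \<theta> = 
        X1 * S \<theta> * poly q x + S \<theta> * (poly (pderiv q) x * poly X x
         - poly q x * (poly X x * L - \<Sigma>) / 2) - S \<theta> * poly ?Q x"
        unfolding N' N Q by (simp add: algebra_simps add_divide_distrib diff_divide_distrib)
      finally show ?thesis
        unfolding 1 2 diff_divide_distrib .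
    qed
    ultimately show "(W has_vector_derivative gap_integrand_deriv l r q a \<theta> u - gap_integrand l r ?Q a \<theta>) (at \<theta>)"
      by (simp add: has_real_derivative_iff_has_vector_derivative)
  qed simp
  moreover have "W pi - W 0 = 0" by (simp add: W_def S_def)
  moreover have "(gap_integrand l r ?Q a has_integral gap_integral l r ?Q a) {0..pi}"
    unfolding gap_integral_def
    by (intro integrable_integral integrable_continuous_real continuous_on_gap_integrand a gap)
  ultimately have "((\<lambda>\<theta>. gap_integrand_deriv l r q a \<theta> u - gap_integrand l r ?Q a \<theta> + gap_integrand l r ?Q a \<theta>)
     has_integral (0 + gap_integral l r ?Q a)) {0..pi}"
    by (metis has_integral_add)
  then show ?thesis by (simp add: integral_unique)
qed

lemma tail_integrand_deriv_eq:
  fixes a u :: "real ^ 'n::{finite,linorder}"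
  assumes a: "a \<in> param_space" and deg: "degree q \<le> d" and card: "CARD('n) = 2 * (d + 1)"
    and \<phi>: "0 < \<phi>" "\<phi> < pi / 2"
  defines "x \<equiv> 1 / cos \<phi>"
  shows "tail_integrand_deriv d q a \<phi> u =
    sin \<phi> / (cos \<phi>)\<^sup>2 * (poly q x * (\<Sum>k\<in>UNIV. u $ k / (x - a $ k)) / 2) / sqrt (curve_poly a x)"
proof -
  let ?Y = "\<lambda>t::real. sin \<phi> / (cos \<phi>)\<^sup>2"
  have "((\<lambda>t. tail_integrand d q (a + t *\<^sub>R u) \<phi>) has_real_derivative tail_integrand_deriv d q a \<phi> u) (at 0)"
    by (rule has_derivative_imp_DERIV_line[OF has_derivative_tail_integrand[OF a]])
  moreover have "\<forall>\<^sub>F t in nhds 0. tail_integrand d q (a + t *\<^sub>R u) \<phi> = ?Y t * diff_form q (a + t *\<^sub>R u) x"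
    using eventually_line_in_param_space[OF a, of u] unfolding x_def
    by eventually_elim (rule tail_integrand_eq(1)[OF _ deg card \<phi>])
  ultimately have 1: "((\<lambda>t. ?Y t * diff_form q (a + t *\<^sub>R u) x) has_real_derivative
      tail_integrand_deriv d q a \<phi> u) (at 0)"
    by (subst DERIV_cong_ev[symmetric]) auto
  have "curve_poly a x > 0"
    using tail_integrand_eq(2)[OF a deg card \<phi>] by (simp add: x_def)
  from DERIV_over_sqrt_curve[of "\<lambda>_. x" 0 ?Y 0, OF _ _ this, of q u] have "((\<lambda>t. ?Y t * diff_form q (a + t *\<^sub>R u) x) has_real_derivative
    sin \<phi> / (cos \<phi>)\<^sup>2 * (poly q x * (\<Sum>k\<in>UNIV. u $ k / (x - a $ k)) / 2) / sqrt (curve_poly a x)) (at 0)"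
    by simp
  from DERIV_unique[OF 1 this] show ?thesis .
qed

text \<open>
  Here the substitution does not depend on \<open>a\<close>, and the exact term is \<open>- B / sqrt f\<close> alone. The quotient \<open>B / sqrt f\<close> is
  \<open>0\<close> at \<open>x = 1\<close> and tends to \<open>1\<close> at infinity because \<open>B\<close> is monic of half the degree of \<open>f\<close>.
\<close>
lemma tail_variation:
  fixes a :: "real ^ 'n::{finite,linorder}"
  assumes a: "a \<in> param_space" and adm: "normalized_velocity A a u q" and deg: "degree q \<le> d"
    and card: "card A = d + 2" "CARD('n) = 2 * (d + 1)"
  shows "integral {0..pi/2} (\<lambda>\<phi>. tail_integrand_deriv d q a \<phi> u) =
    tail_integral d (variation_numerator A a u q) a - 1"
proof -
  let ?B = "branch_poly A a" and ?Q = "variation_numerator A a u q"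
  have degQ: "degree ?Q \<le> d" by (rule degree_variation_numerator[OF adm deg card])
  \<comment> \<open>The boundary term \<open>B / sqrt f\<close>, in a form that is continuous up to \<open>x = 1\<close> and \<open>x = \<infinity>\<close>.\<close>
  define W where "W \<phi> = sin \<phi> * (\<Prod>k\<in>-A. 1 - a $ k * cos \<phi>) / sqrt (\<Prod>k\<in>UNIV. 1 - a $ k * cos \<phi>)" for \<phi>
  have cardc: "card (-A) = d"
    using card by (simp add: Compl_eq_Diff_UNIV card_Diff_subset)
  have W: "W \<phi> = diff_form ?B a (1 / cos \<phi>)" if \<phi>: "\<phi> \<in> {0<..<pi/2}" for \<phi>
  proof -
    define s where "s = cos \<phi>"
    define C where "C = (\<Prod>k\<in>-A. 1 - a $ k * s)"
    have s: "s > 0" using \<phi> by (simp add: s_def cos_gt_zero)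
    have sin: "sin \<phi> > 0" using \<phi> by (simp add: sin_gt_zero)
    have "(\<Prod>k\<in>-A. 1 / s - a $ k) = (\<Prod>k\<in>-A. (1 - a $ k * s) / s)"
      using s by (intro prod.cong) (auto simp: field_simps)
    also have "\<dots> = C / s ^ d"
      by (simp add: prod_dividef C_def cardc)
    finally have "poly ?B (1 / s) = (1 - s\<^sup>2) / s\<^sup>2 * (C / s ^ d)"
      using s by (simp add: poly_branch_poly diff_divide_distrib power_divide)
    also have "1 - s\<^sup>2 = sin \<phi> * sin \<phi>"
      by (simp add: s_def sin_squared_eq flip: power2_eq_square)
    finally have B: "poly ?B (1 / s) = sin \<phi> * sin \<phi> * C / s ^ (d + 2)"
      unfolding power_add by (simp add: mult_ac)
    show ?thesis
      using tail_integrand_eq(3)[OF a deg card(2), of \<phi>] \<phi> sin s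
      unfolding diff_form_def s_def[symmetric] B W_def C_def[symmetric] by (simp del: power_Suc)
  qed
  have "((\<lambda>\<phi>. tail_integrand d ?Q a \<phi> - tail_integrand_deriv d q a \<phi> u) has_integral (W (pi/2) - W 0)) {0..pi/2}"
  proof (rule fundamental_theorem_of_calculus_interior)
    have "(\<Prod>k\<in>UNIV. 1 - a $ k * cos \<phi>) \<noteq> 0" for \<phi>
      using tail_prod_pos[OF a, of \<phi> UNIV] by linarith
    then show "continuous_on {0..pi/2} W"
      unfolding W_def by (intro continuous_intros) (simp del: prod_zero_iff)
    fix \<phi> assume \<phi>: "\<phi> \<in> {0<..<pi/2}"
    define x where "x = 1 / cos \<phi>"
    have pos: "curve_poly a x > 0"
      using tail_integrand_eq(2)[OF a deg card(2), of \<phi>] \<phi> by (simp add: x_def)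
    have cos: "cos \<phi> > 0" using \<phi> by (simp add: cos_gt_zero)
    let ?D = "(poly (pderiv ?B) x - poly ?B x * curve_log_deriv a x / 2) / sqrt (curve_poly a x) * (sin \<phi> / (cos \<phi>)\<^sup>2)"
    have "((\<lambda>\<phi>. 1 / cos \<phi>) has_real_derivative sin \<phi> / (cos \<phi>)\<^sup>2) (at \<phi>)"
      using cos by (auto intro!: derivative_eq_intros simp: power2_eq_square)
    then have "((\<lambda>\<phi>. diff_form ?B a (1 / cos \<phi>)) has_real_derivative ?D) (at \<phi>)"
      by (rule DERIV_chain2[where f = "diff_form ?B a" and g = "\<lambda>\<phi>. 1 / cos \<phi>",
          OF DERIV_diff_form[OF pos, unfolded x_def], folded x_def])
    then have "(W has_real_derivative ?D) (at \<phi>)"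
      by (rule has_field_derivative_transform_within_open[where S = "{0<..<pi/2}"]) (use \<phi> W in auto)
    moreover have "?D = tail_integrand d ?Q a \<phi> - tail_integrand_deriv d q a \<phi> u"
    proof -
      have "poly (pderiv ?B) x - poly ?B x * curve_log_deriv a x / 2 = 
        poly ?Q x - poly q x * (\<Sum>k\<in>UNIV. u $ k / (x - a $ k)) / 2"
        using variation_identity[OF adm, of x] pos by simp
      moreover have "tail_integrand d ?Q a \<phi> = sin \<phi> / (cos \<phi>)\<^sup>2 * (poly ?Q x / sqrt (curve_poly a x))"
        using tail_integrand_eq(1)[OF a degQ card(2), of \<phi>] \<phi> by (simp add: diff_form_def x_def)
      moreover have "tail_integrand_deriv d q a \<phi> u = sin \<phi> / (cos \<phi>)\<^sup>2 * 
          (poly q x * (\<Sum>k\<in>UNIV. u $ k / (x - a $ k)) / 2) / sqrt (curve_poly a x)"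
        using tail_integrand_deriv_eq[OF a deg card(2), of \<phi> u] \<phi> by (simp add: x_def)
      ultimately show ?thesis by (simp only:) (simp add: diff_divide_distrib algebra_simps)
    qed
    ultimately show "(W has_vector_derivative tail_integrand d ?Q a \<phi> - tail_integrand_deriv d q a \<phi> u) (at \<phi>)"
      by (simp add: has_real_derivative_iff_has_vector_derivative)
  qed simp
  moreover have "W (pi/2) - W 0 = 1" by (simp add: W_def)
  moreover have "(tail_integrand d ?Q a has_integral tail_integral d ?Q a) {0..pi/2}"
    unfolding tail_integral_def
    by (intro integrable_integral integrable_continuous_real continuous_on_tail_integrand a)
  ultimately have "((\<lambda>\<phi>. tail_integrand d ?Q a \<phi> - (tail_integrand d ?Q a \<phi> - tail_integrand_deriv d q a \<phi> u))
     has_integral (tail_integral d ?Q a - 1)) {0..pi/2}"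
    by (metis has_integral_diff)
  then show ?thesis by (simp add: integral_unique)
qed

section \<open>The periods as regularised integrals\<close>

text \<open>
  Absolute integrability of the possibly unbounded \<open>f\<close>, on a possibly unbounded interval, is obtained from the
  substitution rule for nonnegative functions applied to its absolute value.
\<close>
lemma interval_integral_substitution_continuous:
  fixes f g g' G :: "real \<Rightarrow> real"
  assumes cd: "c < d"
    and deriv: "\<And>x. c < x \<Longrightarrow> x < d \<Longrightarrow> (g has_real_derivative g' x) (at x)"
    and contf: "\<And>x. c < x \<Longrightarrow> x < d \<Longrightarrow> isCont f (g x)"
    and contg': "\<And>x. c < x \<Longrightarrow> x < d \<Longrightarrow> isCont g' x"
    and g'_nonneg: "\<And>x. c \<le> x \<Longrightarrow> x \<le> d \<Longrightarrow> 0 \<le> g' x"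
    and A: "((\<lambda>x. ereal (g x)) \<longlongrightarrow> A) (at_right c)"
    and B: "((\<lambda>x. ereal (g x)) \<longlongrightarrow> B) (at_left d)"
    and f: "f \<in> borel_measurable borel"
    and G: "continuous_on {c..d} G" "\<And>x. c < x \<Longrightarrow> x < d \<Longrightarrow> G x = g' x * f (g x)"
  shows "(LBINT x=A..B. f x) = integral {c..d} G"
proof -
  have A': "((ereal \<circ> g \<circ> real_of_ereal) \<longlongrightarrow> A) (at_right (ereal c))"
    and B': "((ereal \<circ> g \<circ> real_of_ereal) \<longlongrightarrow> B) (at_left (ereal d))"
    unfolding ereal_tendsto_simps1 using A B by (simp_all add: o_def)
  have intG: "set_integrable lborel {c..d} G"
    by (rule borel_integrable_atLeastAtMost') (rule G)
  then have G_open: "set_integrable lborel (einterval (ereal c) (ereal d)) G"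
    by (rule set_integrable_subset) auto
  have "set_integrable lborel (einterval (ereal c) (ereal d)) (\<lambda>x. \<bar>G x\<bar>)"
    using G_open by (rule set_integrable_abs)
  then have abs: "set_integrable lborel (einterval (ereal c) (ereal d)) (\<lambda>x. \<bar>f (g x)\<bar> * g' x)"
    by (rule set_integrable_cong[THEN iffD1, rotated -1])
      (auto simp: G(2) abs_mult g'_nonneg mult.commute)
  have "set_integrable lborel (einterval A B) (\<lambda>x. \<bar>f x\<bar>)"
    by (rule interval_integral_substitution_nonneg(1)[OF _ _ _ _ _ _ A' B' abs])
      (use cd deriv contf contg' g'_nonneg in \<open>auto intro!: continuous_intros\<close>)
  then have int_f: "set_integrable lborel (einterval A B) f"
    using f by (subst (asm) set_integrable_abs_iff) (auto simp: set_borel_measurable_def)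
  have "(LBINT x=A..B. f x) = (LBINT x=ereal c..ereal d. g' x *\<^sub>R f (g x))"
  proof (rule interval_integral_substitution_integrable[OF _ _ _ _ _ A' B'])
    show "set_integrable lborel (einterval (ereal c) (ereal d)) (\<lambda>x. g' x *\<^sub>R f (g x))"
      using G_open by (rule set_integrable_cong[THEN iffD1, rotated -1]) (auto simp: G(2))
  qed (use cd deriv contf contg' g'_nonneg int_f in auto)
  also have "\<dots> = (LBINT x=ereal c..ereal d. G x)"
    using cd by (intro interval_integral_cong) (auto simp: G(2) min_def max_def)
  also have "\<dots> = integral {c..d} G"
    using cd by (intro interval_integral_eq_integral intG) auto
  finally show ?thesis .
qed

lemma borel_measurable_diff_form: "diff_form q a \<in> borel_measurable borel"
proof -
  have "continuous_on UNIV (poly q)" "continuous_on UNIV (curve_poly a)"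
    unfolding curve_poly_def by (intro continuous_intros)+
  note [measurable] = this[THEN borel_measurable_continuous_onI]
  show ?thesis unfolding diff_form_def by measurable
qed

lemma isCont_diff_form: "curve_poly a x > 0 \<Longrightarrow> isCont (diff_form q a) x"
  using DERIV_diff_form DERIV_isCont by blast

lemma gap_period:
  assumes a: "a \<in> param_space" and gap: "is_gap l r"
  shows "(LBINT x=ereal (a $ l)..ereal (a $ r). diff_form q a x) = gap_integral l r q a"
  unfolding gap_integral_def
proof (rule interval_integral_substitution_continuous)
  let ?g = "gap_point l r a" and ?g' = "\<lambda>\<theta>. (a $ r - a $ l) / 2 * sin \<theta>"
  have lr: "a $ l < a $ r" using param_spaceD(1)[OF a Compl_gap(3)[OF gap]] .
  show D: "(?g has_real_derivative ?g' \<theta>) (at \<theta>)" for \<theta>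
    unfolding gap_point_def by (auto intro!: derivative_eq_intros)
  show "isCont (diff_form q a) (?g \<theta>)" if "0 < \<theta>" "\<theta> < pi" for \<theta>
    by (rule isCont_diff_form[OF sqrt_curve_poly_gap_point(2)[OF a gap that]])
  show "gap_integrand l r q a \<theta> = ?g' \<theta> * diff_form q a (?g \<theta>)" if "0 < \<theta>" "\<theta> < pi" for \<theta>
    by (rule gap_integrand_eq[OF a gap that])
  show "0 \<le> ?g' \<theta>" if "0 \<le> \<theta>" "\<theta> \<le> pi" for \<theta>
    using lr sin_ge_zero[OF that] by simp
  have lim: "(?g \<longlongrightarrow> ?g \<theta>) (at \<theta> within S)" for \<theta> S
    using DERIV_isCont[OF D] continuous_at_imp_continuous_at_within continuous_within by blast
  have "?g 0 = a $ l" "?g pi = a $ r" by (auto simp: gap_point_def field_simps)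
  then show "((\<lambda>x. ereal (?g x)) \<longlongrightarrow> ereal (a $ l)) (at_right 0)"
    "((\<lambda>x. ereal (?g x)) \<longlongrightarrow> ereal (a $ r)) (at_left pi)"
    using lim[of 0 "{0<..}"] lim[of pi "{..<pi}"] by simp_all
qed (auto intro!: borel_measurable_diff_form continuous_on_gap_integrand a gap)

lemma tail_period:
  fixes a :: "real ^ 'n::{finite,linorder}"
  assumes a: "a \<in> param_space" and deg: "degree q \<le> d" and card: "CARD('n) = 2 * (d + 1)"
  shows "(LBINT x=ereal 1..\<infinity>. diff_form q a x) = tail_integral d q a"
  unfolding tail_integral_def
proof (rule interval_integral_substitution_continuous)
  let ?g = "\<lambda>\<phi>. 1 / cos \<phi> :: real" and ?g' = "\<lambda>\<phi>. sin \<phi> / (cos \<phi>)\<^sup>2"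
  have cos: "cos \<phi> > 0" if "0 < \<phi>" "\<phi> < pi/2" for \<phi> :: real
    using that by (simp add: cos_gt_zero)
  show "(?g has_real_derivative ?g' \<phi>) (at \<phi>)" "isCont ?g' \<phi>" if "0 < \<phi>" "\<phi> < pi/2" for \<phi>
    using cos[OF that] by (auto intro!: derivative_eq_intros continuous_intros simp: power2_eq_square)
  show "isCont (diff_form q a) (?g \<phi>)" if "0 < \<phi>" "\<phi> < pi/2" for \<phi>
    by (rule isCont_diff_form[OF tail_integrand_eq(2)[OF a deg card that]])
  show "tail_integrand d q a \<phi> = ?g' \<phi> * diff_form q a (?g \<phi>)" if "0 < \<phi>" "\<phi> < pi/2" for \<phi>
    by (rule tail_integrand_eq(1)[OF a deg card that])
  show "0 \<le> ?g' \<phi>" if "0 \<le> \<phi>" "\<phi> \<le> pi/2" for \<phi>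
    using that by (simp add: sin_ge_zero)
  have "(?g \<longlongrightarrow> 1 / cos 0) (at_right 0)"
    by (intro tendsto_intros) auto
  then show "((\<lambda>x. ereal (?g x)) \<longlongrightarrow> ereal 1) (at_right 0)" by simp
  have "((\<lambda>\<phi>. cos \<phi> :: real) \<longlongrightarrow> cos (pi/2)) (at_left (pi/2))"
    by (intro tendsto_intros)
  moreover have "\<forall>\<^sub>F \<phi> in at_left (pi/2). 0 < cos \<phi>"
    using eventually_at_left[of 0 "pi/2"] cos by (auto intro!: exI[of _ 0])
  ultimately have "filterlim (\<lambda>\<phi>. inverse (cos \<phi> :: real)) at_top (at_left (pi/2))"
    by (intro filterlim_inverse_at_top) auto
  then show "((\<lambda>x. ereal (?g x)) \<longlongrightarrow> \<infinity>) (at_left (pi/2))"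
    by (simp add: tendsto_PInfty_eq_at_top inverse_eq_divide)
qed (auto intro!: borel_measurable_diff_form continuous_on_tail_integrand a)

lemma gap_integral_sum:
  assumes "a \<in> param_space" "is_gap l r" "finite I"
  shows "gap_integral l r (\<Sum>i\<in>I. smult (z i) (p i)) a = (\<Sum>i\<in>I. z i * gap_integral l r (p i) a)"
proof -
  have "gap_integrand l r (\<Sum>i\<in>I. smult (z i) (p i)) a = (\<lambda>\<theta>. \<Sum>i\<in>I. z i * gap_integrand l r (p i) a \<theta>)"
    by (auto simp: gap_integrand_def fun_eq_iff poly_sum sum_divide_distrib)
  then show ?thesis
    unfolding gap_integral_def using assms
    by (simp add: integral_sum integrable_continuous_real continuous_on_gap_integrand continuous_on_mult)
qed

lemma tail_integral_sum:
  assumes "a \<in> param_space" "finite I"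
  shows "tail_integral d (\<Sum>i\<in>I. smult (z i) (p i)) a = (\<Sum>i\<in>I. z i * tail_integral d (p i) a)"
proof -
  have "poly_at_infinity d (\<Sum>i\<in>I. smult (z i) (p i)) s = (\<Sum>i\<in>I. z i * poly_at_infinity d (p i) s)" for s
    by (simp add: poly_at_infinity_def coeff_sum sum_distrib_left sum_distrib_right mult_ac) (rule sum.swap)
  then have "tail_integrand d (\<Sum>i\<in>I. smult (z i) (p i)) a = (\<lambda>\<phi>. \<Sum>i\<in>I. z i * tail_integrand d (p i) a \<phi>)"
    by (auto simp: tail_integrand_def fun_eq_iff sum_divide_distrib)
  then show ?thesis
    unfolding tail_integral_def using assms
    by (simp add: integral_sum integrable_continuous_real continuous_on_tail_integrand continuous_on_mult)
qed

section \<open>Polynomials are determined by their gap integrals\<close>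

text \<open>
  Rolle's theorem for the primitive of the regularised integrand, which vanishes at both ends.
\<close>
lemma gap_integral_zero_root:
  assumes a: "a \<in> param_space" and gap: "is_gap l r" and zero: "gap_integral l r q a = 0"
  shows "\<exists>x. a $ l < x \<and> x < a $ r \<and> poly q x = 0"
proof -
  let ?G = "gap_integrand l r q a"
  define F where "F \<theta> = integral {0..\<theta>} ?G" for \<theta>
  have cont: "continuous_on {0..pi} ?G" by (rule continuous_on_gap_integrand[OF a gap])
  have F': "(F has_derivative (\<lambda>h. h * ?G \<theta>)) (at \<theta>)" if "0 < \<theta>" "\<theta> < pi" for \<theta>
  proof -
    have "(F has_vector_derivative ?G \<theta>) (at \<theta> within {0..pi})"
      unfolding F_def using that by (intro integral_has_vector_derivative cont) auto
    then show ?thesis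
      using that at_within_Icc_at[of 0 \<theta> pi] by (simp add: has_vector_derivative_def)
  qed
  have "continuous_on {0..pi} F"
    unfolding F_def by (intro indefinite_integral_continuous_1 integrable_continuous_real cont)
  moreover have "F 0 = F pi" using zero by (simp add: F_def gap_integral_def)
  ultimately obtain \<theta> where \<theta>: "0 < \<theta>" "\<theta> < pi" "(\<lambda>h. h * ?G \<theta>) = (\<lambda>h. 0)"
    using Rolle_deriv[of 0 pi F "\<lambda>\<theta> h. h * ?G \<theta>"] F' by auto
  have "?G \<theta> = 0" using fun_cong[OF \<theta>(3), of 1] by simp
  then have "poly q (gap_point l r a \<theta>) = 0"
    using gap_cofactor_point_pos[OF a gap, of \<theta>] by (simp add: gap_integrand_def)
  moreover have "gap_point l r a \<theta> \<noteq> a $ l" "gap_point l r a \<theta> \<noteq> a $ r"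
    using sqrt_curve_poly_gap_point(2)[OF a gap \<theta>(1,2)] by (auto simp: curve_poly_gap[OF Compl_gap(2)[OF gap]])
  ultimately show ?thesis
    using gap_point_bounds[OF a gap, of \<theta>] by (intro exI[of _ "gap_point l r a \<theta>"]) auto
qed

abbreviation lower_end :: "'m::{finite,linorder} \<Rightarrow> 'n::{finite,linorder}"
  where "lower_end j \<equiv> nth_index (2 * index_pos j - 1)"
abbreviation upper_end :: "'m::{finite,linorder} \<Rightarrow> 'n::{finite,linorder}"
  where "upper_end j \<equiv> nth_index (2 * index_pos j)"

lemma index_pos_bounds: "1 \<le> index_pos j" "index_pos (j::'m::{finite,linorder}) \<le> CARD('m)"
  by (auto simp: index_pos_def Suc_le_eq card_gt_0_iff intro: card_mono)

lemma index_pos_less: "j < j' \<Longrightarrow> index_pos j < index_pos (j'::'m::{finite,linorder})"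
  unfolding index_pos_def by (intro psubset_card_mono) auto

lemma nth_index_less:
  assumes "1 \<le> k" "k < k'" "k' \<le> CARD('n::{finite,linorder})"
  shows "(nth_index k :: 'n) < nth_index k'"
  unfolding nth_index_def using assms
  by (intro sorted_wrt_nth_less[OF strict_sorted_list_of_set]) auto

lemma nth_index_surj: "\<exists>k. 1 \<le> k \<and> k \<le> CARD('n::{finite,linorder}) \<and> i = (nth_index k :: 'n)"
proof -
  have "i \<in> set (sorted_list_of_set UNIV)" by simp
  then obtain k where "k < CARD('n)" "sorted_list_of_set UNIV ! k = i"
    unfolding in_set_conv_nth by auto
  then show ?thesis by (intro exI[of _ "Suc k"]) (auto simp: nth_index_def)
qed

lemma nth_index_less_iff:
  assumes "1 \<le> k" "k \<le> CARD('n::{finite,linorder})" "1 \<le> k'" "k' \<le> CARD('n)"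
  shows "(nth_index k :: 'n) < nth_index k' \<longleftrightarrow> k < k'"
  using nth_index_less[of k k', where 'n = 'n] nth_index_less[of k' k, where 'n = 'n] assms
  by (cases k k' rule: linorder_cases) auto

lemma card_above_nth_index:
  assumes "1 \<le> k" "k \<le> CARD('n::{finite,linorder})"
  shows "card {nth_index k :: 'n<..} = CARD('n) - k"
proof -
  have "{nth_index k :: 'n<..} = nth_index ` {k<..CARD('n)}"
  proof (intro equalityI subsetI)
    fix i :: 'n assume i: "i \<in> {nth_index k<..}"
    obtain k' where "1 \<le> k'" "k' \<le> CARD('n)" "i = nth_index k'" using nth_index_surj by blast
    with i show "i \<in> nth_index ` {k<..CARD('n)}"
      using nth_index_less_iff[of k k', where 'n = 'n] assms by auto
  qed (use assms nth_index_less in auto)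
  moreover have "inj_on (nth_index :: nat \<Rightarrow> 'n) {k<..CARD('n)}"
  proof (rule inj_onI)
    fix x y assume "x \<in> {k<..CARD('n)}" "y \<in> {k<..CARD('n)}" "(nth_index x :: 'n) = nth_index y"
    then show "x = y"
      using nth_index_less_iff[of x y, where 'n = 'n] nth_index_less_iff[of y x, where 'n = 'n]
      by (cases x y rule: linorder_cases) auto
  qed
  ultimately show ?thesis by (simp add: card_image)
qed

lemma is_gap_ends:
  fixes j :: "'m::{finite,linorder}"
  assumes card: "CARD('n::{finite,linorder}) = 2 * CARD('m)"
  shows "is_gap (lower_end j :: 'n) (upper_end j)"
proof -
  have j: "1 \<le> 2 * index_pos j - 1" "2 * index_pos j - 1 < 2 * index_pos j" "2 * index_pos j \<le> CARD('n)"
    using index_pos_bounds[of j] card by auto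
  have "i \<notin> {lower_end j<..<upper_end j}" for i :: 'n
  proof -
    obtain k where "1 \<le> k" "k \<le> CARD('n)" "i = nth_index k" using nth_index_surj by blast
    then show ?thesis
      using nth_index_less_iff[of "2 * index_pos j - 1" k, where 'n = 'n]
        nth_index_less_iff[of k "2 * index_pos j", where 'n = 'n] j by auto
  qed
  then show ?thesis
    using j card by (auto simp: is_gap_def nth_index_less card_above_nth_index)
qed

lemma upper_end_less_lower_end:
  fixes j j' :: "'m::{finite,linorder}"
  assumes card: "CARD('n::{finite,linorder}) = 2 * CARD('m)" and "j < j'"
  shows "(upper_end j :: 'n) < lower_end j'"
  using index_pos_less[OF assms(2)] index_pos_bounds[of j] index_pos_bounds[of j'] card
  by (intro nth_index_less) auto

text \<open>
  Vanishing of all gap integrals forces a root in each of the disjoint gaps, more roots than the degree allows.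
  This gives the invertibility of the period matrix.
\<close>
lemma gap_integrals_determine:
  fixes a :: "real ^ 'n::{finite,linorder}"
  assumes a: "a \<in> param_space" and card: "CARD('n) = 2 * CARD('m::{finite,linorder})"
    and deg: "degree q < CARD('m)"
    and zero: "\<And>j::'m. gap_integral (lower_end j) (upper_end j) q a = 0"
  shows "q = 0"
proof (rule ccontr)
  assume q: "q \<noteq> 0"
  have "\<exists>x. a $ lower_end j < x \<and> x < a $ upper_end j \<and> poly q x = 0" for j :: 'm
    by (rule gap_integral_zero_root[OF a is_gap_ends[OF card] zero])
  then obtain x :: "'m \<Rightarrow> real" where x: "a $ lower_end j < x j" "x j < a $ upper_end j" "poly q (x j) = 0" for j
    by metis
  have less: "x j < x j'" if "j < j'" for j j'
    using x(1)[of j'] x(2)[of j] param_spaceD(1)[OF a upper_end_less_lower_end[OF card that]] by linarith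
  have "inj x"
    by (rule injI) (metis less less_irrefl linorder_less_linear)
  then have "CARD('m) = card (range x)" by (simp add: card_image)
  also have "\<dots> \<le> card {x. poly q x = 0}"
    using x(3) poly_roots_finite[OF q] by (intro card_mono) auto
  also have "\<dots> \<le> degree q" by (rule card_poly_roots_bound[OF q])
  finally show False using deg by simp
qed

section \<open>Polynomial bases and linear systems\<close>

lemma module_smult: "module (smult :: real \<Rightarrow> real poly \<Rightarrow> real poly)"
  by unfold_locales (auto simp: smult_add_right smult_add_left)

lemma poly_basis_span:
  fixes p :: "'i::finite \<Rightarrow> real poly"
  assumes "poly_basis d p" "degree q \<le> d"
  obtains z where "q = (\<Sum>i\<in>UNIV. smult (z i) (p i))"
proof -
  interpret module "smult :: real \<Rightarrow> real poly \<Rightarrow> real poly" by (rule module_smult)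
  have "q \<in> span (range p)" and inj: "inj p"
    using assms by (auto simp: poly_basis_def)
  then obtain w where "q = (\<Sum>v\<in>range p. smult (w v) v)"
    by (auto simp: span_finite)
  also have "\<dots> = (\<Sum>i\<in>UNIV. smult (w (p i)) (p i))"
    using inj by (simp add: sum.reindex)
  finally show ?thesis using that[of "\<lambda>i. w (p i)"] by simp
qed

lemma poly_basis_independent:
  fixes p :: "'i::finite \<Rightarrow> real poly"
  assumes "poly_basis d p" "(\<Sum>i\<in>UNIV. smult (z i) (p i)) = 0"
  shows "z i = 0"
proof -
  interpret module "smult :: real \<Rightarrow> real poly \<Rightarrow> real poly" by (rule module_smult)
  have inj: "inj p" and indep: "independent (range p)"
    using assms by (auto simp: poly_basis_def)
  have "(\<Sum>v\<in>range p. smult (z (inv p v)) v) = 0"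
    using inj assms(2) by (simp add: sum.reindex)
  moreover have "\<forall>u. (\<Sum>v\<in>range p. smult (u v) v) = 0 \<longrightarrow> (\<forall>v\<in>range p. u v = 0)"
    using indep dependent_finite[of "range p"] by auto
  ultimately have "\<forall>v\<in>range p. z (inv p v) = 0"
    by (elim allE impE)
  then show ?thesis using inj by simp
qed

lemma degree_poly_basis:
  assumes "poly_basis d p"
  shows "degree (p i) \<le> d"
proof -
  interpret module "smult :: real \<Rightarrow> real poly \<Rightarrow> real poly" by (rule module_smult)
  have "p i \<in> span (range p)" by (intro span_base) auto
  then show ?thesis using assms by (simp add: poly_basis_def)
qed

lemma matrix_inv_mult_vec:
  fixes A :: "real ^ 'm ^ 'm"
  assumes "invertible A"
  shows "A *v (matrix_inv A *v b) = b"
proof -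
  have "\<exists>B. A ** B = mat 1 \<and> B ** A = mat 1" using assms by (simp add: invertible_def)
  from someI_ex[OF this] have "A ** matrix_inv A = mat 1" by (simp add: matrix_inv_def)
  then show ?thesis by (simp add: matrix_vector_mul_assoc)
qed

lemma differentiable_vecI:
  fixes f :: "'a::real_normed_vector \<Rightarrow> real ^ 'm"
  assumes "\<And>i. (\<lambda>x. f x $ i) differentiable (at a)"
  shows "f differentiable (at a)"
  unfolding differentiable_componentwise_within[of f]
  using assms by (auto simp: Basis_vec_def inner_axis)

lemma differentiable_prod_real:
  fixes f :: "'i \<Rightarrow> 'a::real_normed_vector \<Rightarrow> real"
  assumes "\<And>i. i \<in> I \<Longrightarrow> f i differentiable (at a)"
  shows "(\<lambda>x. \<Prod>i\<in>I. f i x) differentiable (at a)"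
  using assms by (induction I rule: infinite_finite_induct) auto

lemma differentiable_det:
  fixes A :: "'a::real_normed_vector \<Rightarrow> real ^ 'm ^ 'm"
  assumes "\<And>i j. (\<lambda>x. A x $ i $ j) differentiable (at a)"
  shows "(\<lambda>x. det (A x)) differentiable (at a)"
  unfolding det_def using assms
  by (intro differentiable_sum differentiable_mult differentiable_prod_real differentiable_const
      finite_permutations ballI finite)

text \<open>
  By Cramer's rule the solution is a rational function of the entries.
\<close>
lemma differentiable_linear_solution:
  fixes A :: "'a::real_normed_vector \<Rightarrow> real ^ 'm ^ 'm"
  assumes A: "\<And>i j. (\<lambda>x. A x $ i $ j) differentiable (at a)"
    and b: "\<And>i. (\<lambda>x. b x $ i) differentiable (at a)"
    and inv: "\<forall>\<^sub>F x in nhds a. invertible (A x)"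
  shows "(\<lambda>x. matrix_inv (A x) *v b x) differentiable (at a)"
proof -
  define c where "c x = (\<chi> k. det (\<chi> i j. if j = k then b x $ i else A x $ i $ j) / det (A x))" for x
  have "(\<lambda>x. (if j = k then b x $ i else A x $ i $ j)) differentiable (at a)" for i j k
    using A b by (cases "j = k") auto
  moreover have "det (A a) \<noteq> 0"
    using eventually_nhds_x_imp_x[OF inv] by (simp add: invertible_det_nz)
  ultimately have "c differentiable (at a)"
    unfolding c_def using A
    by (intro differentiable_vecI) (auto intro!: differentiable_divide differentiable_det)
  then obtain D where D: "(c has_derivative D) (at a)" by (auto simp: differentiable_def)
  have sol: "matrix_inv (A x) *v b x = c x" if "invertible (A x)" for x
    using matrix_inv_mult_vec[OF that, of "b x"] that
    by (simp add: cramer invertible_det_nz c_def)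
  have ev: "\<forall>\<^sub>F x in nhds a. c x = matrix_inv (A x) *v b x"
    using inv by eventually_elim (rule sol[symmetric])
  have "((\<lambda>x. matrix_inv (A x) *v b x) has_derivative D) (at a)"
  proof (rule has_derivative_transform_eventually)
    show "(c has_derivative D) (at a)" by (rule D)
    show "\<forall>\<^sub>F x in at a. c x = matrix_inv (A x) *v b x"
      using ev by (auto simp: eventually_at_filter elim: eventually_mono)
    show "c a = matrix_inv (A a) *v b a" by (rule eventually_nhds_x_imp_x[OF ev])
  qed simp
  then show ?thesis by (auto simp: differentiable_def)
qed

section \<open>The rank of the period map\<close>

context
  fixes d :: nat and p :: "'m::{finite,linorder} \<Rightarrow> real poly"
  assumes card_m: "CARD('m) = d + 1" and card_n: "CARD('n::{finite,linorder}) = 2 * (d + 1)"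
    and basis: "poly_basis d p"
begin

lemma gap_j: "is_gap (lower_end (j::'m) :: 'n) (upper_end j)"
  by (rule is_gap_ends) (simp add: card_m card_n)

lemma period_matrix_eq:
  assumes "a \<in> (param_space :: (real, 'n) vec set)"
  shows "period_matrix p a $ i $ j = 2 * gap_integral (lower_end j) (upper_end j) (p i) a"
  using gap_period[OF assms gap_j] by (simp add: period_matrix_def)

lemma period_vector_eq:
  assumes "a \<in> (param_space :: (real, 'n) vec set)"
  shows "period_vector p a $ i = 2 * tail_integral d (p i) a"
  using tail_period[OF assms degree_poly_basis[OF basis] card_n] by (simp add: period_vector_def)

text \<open>
  The transposed period matrix sends coefficients of a polynomial in the basis to its gap integrals; so every
  covector arises from a polynomial.
\<close>
lemma transpose_period_matrix:
  assumes a: "a \<in> (param_space :: (real, 'n) vec set)"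
  shows "(transpose (period_matrix p a) *v z) $ j =
    2 * gap_integral (lower_end j) (upper_end j) (\<Sum>i\<in>UNIV. smult (z $ i) (p i)) a"
  unfolding gap_integral_sum[OF a gap_j finite] 
  by (simp add: matrix_vector_mult_def transpose_def period_matrix_eq[OF a] sum_distrib_left mult_ac)

lemma degree_combination: "degree (\<Sum>i\<in>UNIV. smult (z i) (p i)) \<le> d"
  by (rule degree_sum_le[OF finite]) (rule order.trans[OF degree_smult_le degree_poly_basis[OF basis]])

lemma invertible_period_matrix:
  assumes a: "a \<in> (param_space :: (real, 'n) vec set)"
  shows "invertible (period_matrix p a)"
proof -
  have "z = 0" if z: "transpose (period_matrix p a) *v z = 0" for z
  proof -
    let ?q = "\<Sum>i\<in>UNIV. smult (z $ i) (p i)"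
    have "gap_integral (lower_end j) (upper_end j) ?q a = 0" for j :: 'm
      using transpose_period_matrix[OF a, of z j] z by simp
    then have "?q = 0"
      using degree_combination[of "($) z"] card_m card_n
      by (intro gap_integrals_determine[OF a, where 'm = 'm]) auto
    from poly_basis_independent[OF basis this] show ?thesis
      by (simp add: vec_eq_iff)
  qed
  then have "invertible (transpose (period_matrix p a))"
    by (simp add: invertible_left_inverse matrix_left_invertible_ker)
  then show ?thesis
    using transpose_invertible by fastforce
qed

text \<open>
  A form of the definition that is free of the basis and linear in \<open>q\<close>; it holds for the polynomial \<open>Q\<close> too,
  which has no fixed coordinates.
\<close>
lemma period_relation:
  assumes a: "a \<in> (param_space :: (real, 'n) vec set)" and q: "degree q \<le> d"
  shows "(\<Sum>j\<in>UNIV. gap_integral (lower_end j) (upper_end j) q a * period_map p a $ j) = tail_integral d q a"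
proof -
  obtain z where z: "q = (\<Sum>i\<in>UNIV. smult (z i) (p i))"
    using poly_basis_span[OF basis q] .
  have "period_matrix p a *v period_map p a = period_vector p a"
    unfolding period_map_def by (rule matrix_inv_mult_vec[OF invertible_period_matrix[OF a]])
  from arg_cong[OF this, of "\<lambda>v. v $ i" for i]
  have row: "(\<Sum>j\<in>UNIV. gap_integral (lower_end j) (upper_end j) (p i) a * period_map p a $ j) = tail_integral d (p i) a" for i
    by (simp add: matrix_vector_mult_def period_matrix_eq[OF a] period_vector_eq[OF a] mult.assoc flip: sum_distrib_left)
  have "(\<Sum>j\<in>UNIV. gap_integral (lower_end j) (upper_end j) q a * period_map p a $ j) =
     (\<Sum>i\<in>UNIV. z i * (\<Sum>j\<in>UNIV. gap_integral (lower_end j) (upper_end j) (p i) a * period_map p a $ j))"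
    unfolding z gap_integral_sum[OF a gap_j finite] sum_distrib_left sum_distrib_right
    by (subst sum.swap) (simp add: mult_ac)
  also have "\<dots> = tail_integral d q a"
    unfolding row z tail_integral_sum[OF a finite] ..
  finally show ?thesis .
qed

lemma differentiable_period_map:
  assumes a: "a \<in> (param_space :: (real, 'n) vec set)"
  shows "period_map p differentiable (at a)"
proof -
  have ev: "\<forall>\<^sub>F x in nhds a. x \<in> param_space"
    using open_param_space a by (rule eventually_nhds_in_open)
  have "gap_integral (lower_end j) (upper_end j) (p i) differentiable (at a)" for i and j :: 'm
    using has_derivative_gap_integral[OF a gap_j] unfolding differentiable_def by blast
  then have gap_diff: "(\<lambda>x. 2 * gap_integral (lower_end j) (upper_end j) (p i) x) differentiable (at a)" for i and j :: 'm
    by (intro differentiable_mult differentiable_const)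
  have "tail_integral d (p i) differentiable (at a)" for i
    using has_derivative_tail_integral[OF a] unfolding differentiable_def by blast
  then have tail_diff: "(\<lambda>x. 2 * tail_integral d (p i) x) differentiable (at a)" for i
    by (intro differentiable_mult differentiable_const)
  have transfer: "f differentiable (at a)" if "h differentiable (at a)" "\<And>x. x \<in> param_space \<Longrightarrow> f x = h x" for f h :: "(real, 'n) vec \<Rightarrow> real"
  proof -
    obtain D where "(h has_derivative D) (at a)" using \<open>h differentiable _\<close> by (auto simp: differentiable_def)
    then have "(f has_derivative D) (at a)"
      by (rule has_derivative_transform_within_open[OF _ open_param_space a]) (simp add: that(2))
    then show ?thesis by (auto simp: differentiable_def)
  qed
  show ?thesis
    unfolding period_map_def[abs_def]
    using transfer[OF gap_diff period_matrix_eq] transfer[OF tail_diff period_vector_eq] ev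
    by (intro differentiable_linear_solution) (auto elim!: eventually_mono intro: invertible_period_matrix)
qed

text \<open>
  At most \<open>d\<close> of the \<open>2 d + 2\<close> moving branch points are roots of \<open>q\<close>, so \<open>d + 2\<close> others remain.
\<close>
lemma exists_normalized_velocity:
  assumes a: "a \<in> (param_space :: (real, 'n) vec set)" and q: "q \<noteq> 0" "degree q \<le> d"
  obtains A u where "card A = d + 2" "normalized_velocity A a u q"
proof -
  define Z where "Z = {k. poly q (a $ k) = 0}"
  have "inj (($) a)"
    using param_spaceD(1)[OF a] by (intro linorder_injI) (metis less_irrefl)
  then have "card Z = card ((($) a) ` Z)"
    by (simp add: card_image inj_on_subset)
  also have "\<dots> \<le> card {x. poly q x = 0}"
    using poly_roots_finite[OF q(1)] by (intro card_mono) (auto simp: Z_def)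
  also have "\<dots> \<le> d" using card_poly_roots_bound[OF q(1)] q(2) by simp
  finally have "d + 2 \<le> card (-Z)"
    using card_n by (simp add: Compl_eq_Diff_UNIV card_Diff_subset)
  then obtain A where A: "A \<subseteq> -Z" "card A = d + 2"
    by (rule obtain_subset_with_card_n)
  define u :: "(real, 'n) vec" where
    "u = (\<chi> k. if k \<in> A then poly (branch_poly A a) (a $ k) / poly q (a $ k) else 0)"
  have "poly (branch_poly A a) (a $ k) = 0" if "k \<notin> A" for k
    using that by (auto simp: poly_branch_poly prod_zero_iff)
  then have "normalized_velocity A a u q"
    using A(1) by (auto simp: normalized_velocity_def u_def Z_def)
  with A(2) show ?thesis by (rule that)
qed

text \<open>
  Differentiating the period relation for \<open>q\<close> along \<open>u\<close> gives the relation for \<open>Q\<close>, which cancels, and the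
  boundary term at infinity.
\<close>
lemma period_map_deriv_pairing:
  assumes a: "a \<in> (param_space :: (real, 'n) vec set)" and deg: "degree q \<le> d"
    and A: "card A = d + 2" and adm: "normalized_velocity A a u q"
    and D: "(period_map p has_derivative D) (at a)"
  shows "(\<Sum>j\<in>UNIV. gap_integral (lower_end j) (upper_end j) q a * D u $ j) = -1"
proof -
  let ?Q = "variation_numerator A a u q"
  let ?I = "\<lambda>j q b. gap_integral (lower_end j) (upper_end j) q b"
  have degQ: "degree ?Q \<le> d" by (rule degree_variation_numerator[OF adm deg A card_n])
  have D1: "((\<lambda>t. ?I j q (a + t *\<^sub>R u)) has_real_derivative ?I j ?Q a) (at 0)" for j :: 'm
    using has_derivative_imp_DERIV_line[OF has_derivative_gap_integral[OF a gap_j], of j q u]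
    unfolding gap_variation[OF a gap_j adm] .
  have D2: "((\<lambda>t. tail_integral d q (a + t *\<^sub>R u)) has_real_derivative tail_integral d ?Q a - 1) (at 0)"
    using has_derivative_imp_DERIV_line[OF has_derivative_tail_integral[OF a], of d q u]
    unfolding tail_variation[OF a adm deg A card_n] .
  have D3: "((\<lambda>t. period_map p (a + t *\<^sub>R u) $ j) has_real_derivative D u $ j) (at 0)" for j
    by (rule has_derivative_imp_DERIV_line) (rule bounded_linear.has_derivative[OF bounded_linear_vec_nth D])
  have "((\<lambda>t. \<Sum>j\<in>UNIV. ?I j q (a + t *\<^sub>R u) * period_map p (a + t *\<^sub>R u) $ j) has_real_derivative
      (\<Sum>j\<in>UNIV. ?I j ?Q a * period_map p a $ j + ?I j q a * D u $ j)) (at 0)"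
    by (rule DERIV_sum) (use DERIV_mult[OF D1 D3] in \<open>simp add: mult.commute\<close>)
  moreover have "\<forall>\<^sub>F t in nhds 0. (\<Sum>j\<in>UNIV. ?I j q (a + t *\<^sub>R u) * period_map p (a + t *\<^sub>R u) $ j) = tail_integral d q (a + t *\<^sub>R u)"
    using eventually_line_in_param_space[OF a, of u] by eventually_elim (rule period_relation[OF _ deg])
  ultimately have "((\<lambda>t. tail_integral d q (a + t *\<^sub>R u)) has_real_derivative
      (\<Sum>j\<in>UNIV. ?I j ?Q a * period_map p a $ j + ?I j q a * D u $ j)) (at 0)"
    by (subst DERIV_cong_ev[symmetric]) auto
  from DERIV_unique[OF this D2] period_relation[OF a degQ] show ?thesis
    by (simp add: sum.distrib)
qed

theorem rank_jacobian_period_map: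
  assumes a: "a \<in> (param_space :: (real, 'n) vec set)"
  shows "rank (jacobian (period_map p) (at a)) = d + 1"
proof -
  let ?J = "jacobian (period_map p) (at a)"
  have D: "(period_map p has_derivative (\<lambda>h. ?J *v h)) (at a)"
    using differentiable_period_map[OF a] by (simp add: jacobian_works)
  have "y = 0" if y: "transpose ?J *v y = 0" for y
  proof (rule ccontr)
    assume "y \<noteq> 0"
    obtain B where "transpose (period_matrix p a) ** B = mat 1"
      using transpose_invertible[OF invertible_period_matrix[OF a]] by (auto simp: invertible_def)
    then have z: "transpose (period_matrix p a) *v (B *v y) = y"
      by (simp add: matrix_vector_mul_assoc)
    define q where "q = (\<Sum>i\<in>UNIV. smult ((B *v y) $ i) (p i))"
    have y_eq: "y $ j = 2 * gap_integral (lower_end j) (upper_end j) q a" for j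
      using transpose_period_matrix[OF a, of "B *v y" j] unfolding z q_def .
    have "q \<noteq> 0"
    proof
      assume "q = 0"
      then have "y $ j = 0" for j
        unfolding y_eq by (simp add: gap_integral_def gap_integrand_def[abs_def])
      with \<open>y \<noteq> 0\<close> show False by (simp add: vec_eq_iff)
    qed
    moreover have deg: "degree q \<le> d" unfolding q_def by (rule degree_combination)
    ultimately obtain A u where Au: "card A = d + 2" "normalized_velocity A a u q"
      using exists_normalized_velocity[OF a] by blast
    have "y \<bullet> (?J *v u) = 0"
      using y by (simp add: transpose_matrix_vector flip: dot_lmul_matrix)
    also have "y \<bullet> (?J *v u) = 2 * (\<Sum>j\<in>UNIV. gap_integral (lower_end j) (upper_end j) q a * (?J *v u) $ j)"
      unfolding inner_vec_def y_eq by (simp add: sum_distrib_left mult.assoc)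
    also have "\<dots> = - 2"
      using period_map_deriv_pairing[OF a deg Au D] by simp
    finally show False by simp
  qed
  then have "inj ((*v) (transpose ?J))"
    by (simp add: vec.inj_iff_eq_0)
  then have "rank (transpose ?J) = CARD('m)"
    by (simp add: full_rank_injective)
  then show ?thesis by (simp add: rank_transpose card_m)
qed

end

text \<open>
  The empty set is the zero set of the constant \<open>1\<close>, whose power series has only the term at the zero multi-index.
\<close>
lemma real_analytic_subset_empty:
  fixes U :: "(real ^ 'n) set"
  assumes "open U"
  shows "real_analytic_subset U {}"
proof -
  have one: "(\<lambda>_. 1) real_analytic_on U"
    unfolding real_analytic_on_def
  proof (intro ballI exI conjI)
    fix x y :: "real ^ 'n"
    let ?c = "\<lambda>\<alpha>. if \<alpha> = (\<lambda>_. 0) then 1 else 0 :: real"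
    show "((\<lambda>\<alpha>. ?c \<alpha> * (\<Prod>i\<in>UNIV. (y $ i - x $ i) ^ \<alpha> i)) has_sum 1) UNIV"
      by (rule has_sum_finite_neutralI[where B = "{\<lambda>_. 0}"]) auto
  qed (rule zero_less_one)
  show ?thesis
    unfolding real_analytic_subset_def
    using assms one by (intro conjI ballI exI[of _ U] exI[of _ "{\<lambda>_. 1}"]) auto
qed

theorem mainTheorem2:
  fixes g :: nat
    and p :: "'m::{finite,linorder} \<Rightarrow> real poly"
    and U :: "(real ^ 'n::{finite,linorder}) set"
  assumes g: "g > 0"
    and dim_target: "CARD('m) = g"
    and dim_source: "CARD('n) = 2 * g"
    and basis: "poly_basis (g - 1) p"
    and U: "U = param_space"
  shows "\<exists>Z. real_analytic_subset U Z \<and> Z \<noteq> U \<and>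
           (\<forall>a\<in>U - Z. (period_map p :: real ^ 'n::{finite,linorder} \<Rightarrow> real ^ 'm::{finite,linorder}) differentiable (at a) \<and>
                       rank (jacobian (period_map p :: real ^ 'n::{finite,linorder} \<Rightarrow> real ^ 'm::{finite,linorder}) (at a)) = g)"
proof (intro exI conjI ballI)
  have card_m: "CARD('m) = g - 1 + 1" and card_n: "CARD('n) = 2 * (g - 1 + 1)"
    using g dim_target dim_source by auto
  show "real_analytic_subset U {}"
    unfolding U by (rule real_analytic_subset_empty[OF open_param_space])
  show "{} \<noteq> U"
    using param_space_nonempty by (auto simp: U)
  fix a assume "a \<in> U - {}"
  then have a: "a \<in> param_space" by (simp add: U)
  show "(period_map p :: (real, 'n) vec \<Rightarrow> (real, 'm) vec) differentiable (at a)"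
    by (rule differentiable_period_map[OF card_m card_n basis a])
  show "rank (jacobian (period_map p :: (real, 'n) vec \<Rightarrow> (real, 'm) vec) (at a)) = g"
    using rank_jacobian_period_map[OF card_m card_n basis a] g by simp
qed

end
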